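(* Let $S_0=\{x_1^5+x_2^5+1=0\}\subset\mathbb{CP}^2$ in the inhomogeneous coordinates $(x_1,x_2)$, with $r_k=|x_k|$, and for $t\in[0,1]$ let $$S_t=\left\{\mathcal{F}_t(x)=\left(\left(\frac{\max(1,r_2)}{\max(r_1,r_2)}\right)^tx_1,\ \left(\frac{\max(1,r_1)}{\max(r_1,r_2)}\right)^tx_2\right)\ \Big|\ x_1^5+x_2^5+1=0\right\}.$$ Then $S_t$ is symplectic with respect to the Fubini-Study form on $\mathbb{CP}^2$ when $(r_1-1)(r_2-1)(r_1-r_2)\neq0$; i.e. for every $t\in[0,1]$ the part of $S_t$ that is the image under $\mathcal{F}_t$ of $\{x\in S_0: (r_1-1)(r_2-1)(r_1-r_2)\ne0\}$ is symplectic.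
   Context: Homogeneous coordinates on $\mathbb{CP}^2$ are $[z_0,z_1,z_2]$ and $x_k=z_k/z_0$, $k=1,2$. Up to a positive constant and the factor $\sqrt{-1}$ the Fubini-Study Kähler form is $$\omega=\frac{(1+|x_2|^2)dx_1\wedge d\bar x_1+(1+|x_1|^2)dx_2\wedge d\bar x_2-\bar x_1x_2dx_1\wedge d\bar x_2-\bar x_2x_1dx_2\wedge d\bar x_1}{(1+|x|^2)^2}.$$ Here $r_1=|x_1|,r_2=|x_2|$ are the absolute values of the coordinates of the point $x\in S_0$ parametrizing $S_t$. A surface is symplectic if the restriction of the symplectic form to it is nondegenerate. *)

theory Defs
  imports "HOL-Analysis.Analysis"
begin

text \<open>
  The affine chart \<open>z\<^sub>0 \<noteq> 0\<close> of the complex projective plane is the type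
  \<^typ>\<open>complex \<times> complex\<close> of the inhomogeneous coordinates \<open>(x\<^sub>1, x\<^sub>2)\<close>, regarded as a
  four-dimensional real vector space; tangent vectors are elements of the same type.
  The points of the quintic curve on the line \<open>z\<^sub>0 = 0\<close> satisfy \<open>z\<^sub>1^5 + z\<^sub>2^5 = 0\<close>, so that
  \<open>\<bar>z\<^sub>1\<bar> = \<bar>z\<^sub>2\<bar>\<close> there: they are never in the part of the curve where \<open>r\<^sub>1 \<noteq> r\<^sub>2\<close>.
\<close>

subsection \<open>The curve and its deformation\<close>

definition S0 :: "(complex \<times> complex) set" where
  "S0 = {(x1, x2). x1 ^ 5 + x2 ^ 5 + 1 = 0}"

definition F :: "real \<Rightarrow> complex \<times> complex \<Rightarrow> complex \<times> complex" where
  "F t = (\<lambda>(x1, x2). let r1 = cmod x1; r2 = cmod x2 in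
     (of_real ((max 1 r2 / max r1 r2) powr t) * x1,
      of_real ((max 1 r1 / max r1 r2) powr t) * x2))"

subsection \<open>The Fubini-Study form\<close>

type_synonym one_form = "complex \<times> complex \<Rightarrow> complex"
type_synonym two_form = "complex \<times> complex \<Rightarrow> complex \<times> complex \<Rightarrow> complex"

definition wedge :: "one_form \<Rightarrow> one_form \<Rightarrow> two_form" where
  "wedge \<alpha> \<beta> = (\<lambda>v w. \<alpha> v * \<beta> w - \<alpha> w * \<beta> v)"

definition dx1 :: one_form where "dx1 v = fst v"
definition dx2 :: one_form where "dx2 v = snd v"
definition dx1_bar :: one_form where "dx1_bar v = cnj (fst v)"
definition dx2_bar :: one_form where "dx2_bar v = cnj (snd v)"

definition omega :: "complex \<times> complex \<Rightarrow> two_form" where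
  "omega = (\<lambda>(x1, x2) v w.
     ((1 + of_real ((cmod x2)\<^sup>2)) * wedge dx1 dx1_bar v w
    + (1 + of_real ((cmod x1)\<^sup>2)) * wedge dx2 dx2_bar v w
    - cnj x1 * x2 * wedge dx1 dx2_bar v w
    - cnj x2 * x1 * wedge dx2 dx1_bar v w)
    / (1 + of_real ((cmod x1)\<^sup>2 + (cmod x2)\<^sup>2))\<^sup>2)"

text \<open>\<^const>\<open>omega\<close> takes purely imaginary values on real tangent vectors; the real
  symplectic form is obtained by multiplying it with the imaginary unit.\<close>

definition fubini_study :: "complex \<times> complex \<Rightarrow> complex \<times> complex \<Rightarrow> complex \<times> complex \<Rightarrow> real" where
  "fubini_study x v w = Re (\<i> * omega x v w)"

lemma of_real_fubini_study: "complex_of_real (fubini_study x v w) = \<i> * omega x v w"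
proof -
  have "cnj (omega x v w) = - omega x v w"
    by (cases x, simp add: omega_def wedge_def dx1_def dx2_def dx1_bar_def dx2_bar_def algebra_simps)
      (simp only: minus_divide_left minus_diff_eq)
  then have "cnj (\<i> * omega x v w) = \<i> * omega x v w"
    by simp
  then show ?thesis
    unfolding fubini_study_def by (metis Reals_cnj_iff of_real_Re)
qed

subsection \<open>Symplectic surfaces\<close>

text \<open>\<open>C_diff k U f\<close>, for \<open>U\<close> open in a finite-dimensional space: \<open>f\<close> is of class \<open>C\<^sup>k\<close> on \<open>U\<close>.\<close>

primrec C_diff :: "nat \<Rightarrow> 'a::euclidean_space set \<Rightarrow> ('a \<Rightarrow> 'b::real_normed_vector) \<Rightarrow> bool" where
  "C_diff 0 U f \<longleftrightarrow> continuous_on U f"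
| "C_diff (Suc k) U f \<longleftrightarrow>
     (\<exists>f'. (\<forall>x\<in>U. (f has_derivative f' x) (at x)) \<and> (\<forall>v. C_diff k U (\<lambda>x. f' x v)))"

definition smooth_on :: "'a::euclidean_space set \<Rightarrow> ('a \<Rightarrow> 'b::real_normed_vector) \<Rightarrow> bool" where
  "smooth_on U f \<longleftrightarrow> (\<forall>k. C_diff k U f)"

text \<open>A (not necessarily closed) embedded smooth submanifold of real dimension two,
  given by local parametrizations.\<close>

definition smooth_surface :: "(complex \<times> complex) set \<Rightarrow> bool" where
  "smooth_surface M \<longleftrightarrow>
     (\<forall>p\<in>M. \<exists>V U (\<phi> :: real \<times> real \<Rightarrow> complex \<times> complex) \<psi>.
        open V \<and> p \<in> V \<and> open U \<and> homeomorphism U (M \<inter> V) \<phi> \<psi> \<and> smooth_on U \<phi>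
        \<and> (\<forall>u\<in>U. inj (frechet_derivative \<phi> (at u))))"

definition tangent_space :: "(complex \<times> complex) set \<Rightarrow> complex \<times> complex \<Rightarrow> (complex \<times> complex) set" where
  "tangent_space M p =
     {v. \<exists>\<epsilon>>0. \<exists>\<gamma> :: real \<Rightarrow> complex \<times> complex.
        smooth_on {-\<epsilon><..<\<epsilon>} \<gamma> \<and> \<gamma> ` {-\<epsilon><..<\<epsilon>} \<subseteq> M \<and> \<gamma> 0 = p
        \<and> (\<gamma> has_vector_derivative v) (at 0)}"

definition symplectic_surface :: "(complex \<times> complex) set \<Rightarrow> bool" where
  "symplectic_surface M \<longleftrightarrow> smooth_surface M \<and>
     (\<forall>p\<in>M. \<forall>v\<in>tangent_space M p. v \<noteq> 0 \<longrightarrow> (\<exists>w\<in>tangent_space M p. fubini_study p v w \<noteq> 0))"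

end

theory Submission
  imports Defs
begin

text \<open>
  The map \<^term>\<open>F t\<close> multiplies the two coordinates by positive real numbers. It therefore keeps
  their arguments and moves only their moduli, and on each of the six regions cut out by the order
  of \<open>1, r\<^sub>1, r\<^sub>2\<close> it acts on \<open>(log r\<^sub>1, log r\<^sub>2)\<close> by a constant matrix \<open>(a, b; c, d)\<close>.

  In the logarithmic coordinates \<open>x\<^sub>k = exp \<zeta>\<^sub>k\<close>, \<open>\<zeta>\<^sub>k = \<rho>\<^sub>k + i \<theta>\<^sub>k\<close>, the Fubini-Study form is a
  combination of the forms \<open>d\<rho>\<^sub>j \<and> d\<theta>\<^sub>k\<close> whose coefficients depend on the moduli only. Put
  \<open>X\<^sub>k = x\<^sub>k\<^sup>5\<close>. The quintic becomes the line \<open>X\<^sub>1 + X\<^sub>2 = -1\<close>, along which \<open>d\<zeta>\<^sub>1 = -X\<^sub>2 \<tau>\<close> and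
  \<open>d\<zeta>\<^sub>2 = X\<^sub>1 \<tau>\<close> for one complex differential \<open>\<tau>\<close>. Hence \<open>d\<rho>\<^sub>1 \<and> d\<theta>\<^sub>1\<close>, \<open>d\<rho>\<^sub>2 \<and> d\<theta>\<^sub>2\<close> and
  \<open>d\<rho>\<^sub>1 \<and> d\<theta>\<^sub>2 = d\<rho>\<^sub>2 \<and> d\<theta>\<^sub>1\<close> restrict to \<open>\<bar>X\<^sub>2\<bar>\<^sup>2\<close>, \<open>\<bar>X\<^sub>1\<bar>\<^sup>2\<close> and
  \<open>q = (\<bar>X\<^sub>1\<bar>\<^sup>2 + \<bar>X\<^sub>2\<bar>\<^sup>2 - 1) / 2\<close> times the area form of \<open>\<tau>\<close>. The pulled back form is thus the area
  form times an explicit function of the moduli, the \<open>pullback_density\<close> below up to a positive factor.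
  In every region this function can be rearranged into a sum of nonnegative terms, one of them
  positive (\<open>pullback_density_pos_1_max\<close>, \<open>pullback_density_pos_1_mid\<close>, \<open>pullback_density_pos_1_min\<close>
  and their mirror images under the exchange of the coordinates).

  Nondegeneracy of the pulled back form makes \<^term>\<open>F t\<close> an immersion of the regions of the curve.
  That the image is an embedded surface is a global matter, and for \<open>t = 1\<close> it uses
  the curve: the matrix \<open>(a, b; c, d)\<close> is then singular, and as a map of the whole plane
  \<^term>\<open>F t\<close> is not injective on the regions. On the curve, however, the arguments of \<open>X\<^sub>1\<close> and \<open>X\<^sub>2\<close> determine the point
  unless both numbers are real, and on the real arcs the moduli separate points (\<open>inj_on_F\<close>).
  As the factors by which the coordinates are multiplied are at least \<open>1/2\<close>, the map is proper,
  and so it is a homeomorphism onto its image (\<open>homeomorphism_F\<close>).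

  The surface is parametrized locally by \<open>z = X\<^sub>1\<close>. Such a chart is a product of constants with
  exponentials of logarithms and their real parts, so that its smoothness follows from membership in
  a family of functions that is closed under differentiation (\<open>deriv_closed_log_chart_algebra\<close>).
  Tangent vectors, given as velocities of curves in the surface, lie in the image of the derivative of the chart
  (\<open>velocity_in_range_derivative\<close>).
\<close>

section \<open>Smoothness by closure under differentiation\<close>

text \<open>
  The members of a family that is stable under all directional derivatives have derivatives of every
  order. Exhibiting such a family proves smoothness without product, quotient or chain rules for
  \<^const>\<open>C_diff\<close>.
\<close>

definition deriv_closed :: "'a::real_normed_vector set \<Rightarrow> ('a \<Rightarrow> 'b::real_normed_vector) set \<Rightarrow> bool" where
  "deriv_closed W \<F> \<longleftrightarrow>
     (\<forall>f\<in>\<F>. \<exists>f'. (\<forall>z\<in>W. (f has_derivative f' z) (at z)) \<and> (\<forall>v. (\<lambda>z. f' z v) \<in> \<F>))"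

text \<open>
  The derivative of \<open>l\<close> is the same map \<open>l'\<close> at every point, so the derivative of \<open>f \<circ> l\<close> in a
  direction \<open>v\<close> is again a member of the family composed with \<open>l\<close>, namely the derivative of \<open>f\<close> in
  the direction \<open>l' v\<close>. The lemma serves charts (\<open>l\<close> identifies a real plane with the complex line)
  as well as curves (\<open>l\<close> parametrizes a real line).
\<close>

lemma smooth_on_compose_affine:
  fixes l :: "'a::euclidean_space \<Rightarrow> 'b::real_normed_vector"
  assumes closed: "deriv_closed W \<F>" and f: "f \<in> \<F>"
    and l: "\<And>x. (l has_derivative l') (at x)" and sub: "l ` U \<subseteq> W"
  shows "smooth_on U (\<lambda>x. f (l x))"
proof -
  have "C_diff k U (\<lambda>x. f (l x))" for k
    using f
  proof (induction k arbitrary: f)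
    case 0
    then obtain f' where "\<forall>z\<in>W. (f has_derivative f' z) (at z)"
      using closed unfolding deriv_closed_def by blast
    then have "continuous_on W f"
      by (meson continuous_at_imp_continuous_on has_derivative_continuous)
    moreover have "continuous_on U l"
      by (meson continuous_at_imp_continuous_on has_derivative_continuous l)
    ultimately show ?case
      using sub by (simp add: continuous_on_compose2)
  next
    case (Suc k)
    obtain f' where f': "\<forall>z\<in>W. (f has_derivative f' z) (at z)" "\<forall>v. (\<lambda>z. f' z v) \<in> \<F>"
      using closed Suc.prems unfolding deriv_closed_def by blast
    have "((\<lambda>x. f (l x)) has_derivative (\<lambda>v. f' (l x) (l' v))) (at x)" if "x \<in> U" for x
      using has_derivative_compose[OF l, of f] f'(1) sub that by blast
    moreover have "C_diff k U (\<lambda>x. f' (l x) (l' v))" for v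
      using Suc.IH[of "\<lambda>z. f' z (l' v)"] f'(2) by simp
    ultimately show ?case
      by (auto intro!: exI[of _ "\<lambda>x v. f' (l x) (l' v)"])
  qed
  then show ?thesis
    by (simp add: smooth_on_def)
qed

text \<open>
  Closure under conjugation supplies real parts, which enter because the charts depend on moduli and
  are differentiated over the reals.
\<close>

inductive_set conj_algebra :: "('a \<Rightarrow> complex) set \<Rightarrow> ('a \<Rightarrow> complex) set" for B where
  gen: "f \<in> B \<Longrightarrow> f \<in> conj_algebra B"
| const: "(\<lambda>_. c) \<in> conj_algebra B"
| add: "f \<in> conj_algebra B \<Longrightarrow> g \<in> conj_algebra B \<Longrightarrow> (\<lambda>z. f z + g z) \<in> conj_algebra B"
| mult: "f \<in> conj_algebra B \<Longrightarrow> g \<in> conj_algebra B \<Longrightarrow> (\<lambda>z. f z * g z) \<in> conj_algebra B"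
| cnj: "f \<in> conj_algebra B \<Longrightarrow> (\<lambda>z. cnj (f z)) \<in> conj_algebra B"

lemma conj_algebra_Re:
  assumes "f \<in> conj_algebra B"
  shows "(\<lambda>z. of_real (Re (f z))) \<in> conj_algebra B"
proof -
  have "(\<lambda>z. (1/2) * (f z + cnj (f z))) \<in> conj_algebra B"
    using assms by (intro conj_algebra.mult conj_algebra.add conj_algebra.const conj_algebra.cnj)
  moreover have "(1/2) * (f z + cnj (f z)) = of_real (Re (f z))" for z
    by (simp add: complex_eq_iff)
  ultimately show ?thesis
    by simp
qed

lemma deriv_closed_conj_algebra:
  assumes gens: "\<And>f. f \<in> B \<Longrightarrow> \<exists>f'. (\<forall>z\<in>W. (f has_derivative f' z) (at z)) \<and> (\<forall>v. (\<lambda>z. f' z v) \<in> conj_algebra B)"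
  shows "deriv_closed W (conj_algebra B)"
  unfolding deriv_closed_def
proof
  fix f assume "f \<in> conj_algebra B"
  then show "\<exists>f'. (\<forall>z\<in>W. (f has_derivative f' z) (at z)) \<and> (\<forall>v. (\<lambda>z. f' z v) \<in> conj_algebra B)"
  proof induction
    case (gen f)
    then show ?case by (rule gens)
  next
    case (const c)
    show ?case
      by (intro exI[of _ "\<lambda>_ _. 0"]) (auto intro: conj_algebra.const)
  next
    case (add f g)
    then obtain f' g' where
      "\<forall>z\<in>W. (f has_derivative f' z) (at z)" "\<forall>v. (\<lambda>z. f' z v) \<in> conj_algebra B"
      "\<forall>z\<in>W. (g has_derivative g' z) (at z)" "\<forall>v. (\<lambda>z. g' z v) \<in> conj_algebra B"
      by blast
    then show ?case
      by (intro exI[of _ "\<lambda>z v. f' z v + g' z v"]) (auto intro!: conj_algebra.add has_derivative_add)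
  next
    case (mult f g)
    then obtain f' g' where
      "\<forall>z\<in>W. (f has_derivative f' z) (at z)" "\<forall>v. (\<lambda>z. f' z v) \<in> conj_algebra B"
      "\<forall>z\<in>W. (g has_derivative g' z) (at z)" "\<forall>v. (\<lambda>z. g' z v) \<in> conj_algebra B"
      by blast
    with mult.hyps show ?case
      by (intro exI[of _ "\<lambda>z v. f z * g' z v + f' z v * g z"])
        (auto intro!: conj_algebra.add conj_algebra.mult has_derivative_mult)
  next
    case (cnj f)
    then obtain f' where
      "\<forall>z\<in>W. (f has_derivative f' z) (at z)" "\<forall>v. (\<lambda>z. f' z v) \<in> conj_algebra B"
      by blast
    then show ?case
      by (intro exI[of _ "\<lambda>z v. cnj (f' z v)"]) (auto intro!: conj_algebra.cnj has_derivative_cnj)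
  qed
qed

lemma deriv_closed_Pair:
  assumes "deriv_closed W \<F>" "deriv_closed W \<G>"
  shows "deriv_closed W {(\<lambda>z. (f z, g z)) | f g. f \<in> \<F> \<and> g \<in> \<G>}"
  unfolding deriv_closed_def
proof
  fix h assume "h \<in> {(\<lambda>z. (f z, g z)) | f g. f \<in> \<F> \<and> g \<in> \<G>}"
  then obtain f g where h: "h = (\<lambda>z. (f z, g z))" and f: "f \<in> \<F>" and g: "g \<in> \<G>"
    by blast
  obtain f' where f': "\<forall>z\<in>W. (f has_derivative f' z) (at z)" "\<forall>v. (\<lambda>z. f' z v) \<in> \<F>"
    using bspec[OF assms(1)[unfolded deriv_closed_def] f] by blast
  obtain g' where g': "\<forall>z\<in>W. (g has_derivative g' z) (at z)" "\<forall>v. (\<lambda>z. g' z v) \<in> \<G>"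
    using bspec[OF assms(2)[unfolded deriv_closed_def] g] by blast
  have "\<forall>z\<in>W. (h has_derivative (\<lambda>v. (f' z v, g' z v))) (at z)"
    using f'(1) g'(1) by (simp add: h has_derivative_Pair)
  moreover have "(\<lambda>z. (f' z v, g' z v)) \<in> {(\<lambda>z. (f z, g z)) | f g. f \<in> \<F> \<and> g \<in> \<G>}" for v
    using f'(2) g'(2) by (intro CollectI exI[of _ "\<lambda>z. f' z v"] exI[of _ "\<lambda>z. g' z v"]) simp
  ultimately show "\<exists>h'. (\<forall>z\<in>W. (h has_derivative h' z) (at z))
      \<and> (\<forall>v. (\<lambda>z. h' z v) \<in> {(\<lambda>z. (f z, g z)) | f g. f \<in> \<F> \<and> g \<in> \<G>})"
    by (intro exI[of _ "\<lambda>z v. (f' z v, g' z v)"]) simp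
qed

section \<open>Curves in the image of an immersion\<close>

text \<open>
  The parameter curve \<open>u\<close> is only known to be continuous. An injective derivative satisfies
  \<open>B * norm h \<le> norm (D h)\<close>, which keeps the difference quotients of \<open>u\<close> bounded; the error of the linear
  approximation then disappears in the limit, and \<open>v\<close> is a limit of vectors in the closed subspace
  \<open>range D\<close>.
\<close>

lemma velocity_in_range_derivative:
  fixes \<phi> :: "'a::euclidean_space \<Rightarrow> 'b::euclidean_space"
  assumes \<phi>: "(\<phi> has_derivative D) (at (u 0))" and "inj D"
    and \<gamma>: "(\<gamma> has_vector_derivative v) (at 0)"
    and u: "isCont u (0::real)"
    and eq: "\<forall>\<^sub>F s in nhds 0. \<gamma> s = \<phi> (u s)"
  shows "v \<in> range D"
proof -
  have D: "bounded_linear D" "linear D"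
    using \<phi> has_derivative_bounded_linear has_derivative_linear by blast+
  obtain B where B: "B > 0" "\<And>h. B * norm h \<le> norm (D h)"
    using linear_inj_bounded_below_pos[OF D(2) \<open>inj D\<close>] by blast
  have \<gamma>0: "\<gamma> 0 = \<phi> (u 0)"
    using eq eventually_nhds_x_imp_x by blast
  define q where "q s = (1/s) *\<^sub>R (\<gamma> s - \<gamma> 0)" for s
  define w where "w s = (1/s) *\<^sub>R (u s - u 0)" for s
  have "((\<lambda>s. norm (q s - v)) \<longlongrightarrow> 0) (at 0)"
    using \<gamma> unfolding has_vector_derivative_def has_derivative_at
  proof (elim conjE, elim Lim_transform_eventually)
    show "\<forall>\<^sub>F s in at 0. norm (\<gamma> (0 + s) - \<gamma> 0 - s *\<^sub>R v) / norm s = norm (q s - v)"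
    proof (rule eventually_at_filter[THEN iffD2], rule always_eventually, intro allI impI)
      fix s :: real assume "s \<noteq> 0"
      then have "q s - v = (1/s) *\<^sub>R (\<gamma> s - \<gamma> 0 - s *\<^sub>R v)"
        by (simp add: q_def scaleR_diff_right)
      then show "norm (\<gamma> (0 + s) - \<gamma> 0 - s *\<^sub>R v) / norm s = norm (q s - v)"
        by simp
    qed
  qed
  then have q: "(q \<longlongrightarrow> v) (at 0)"
    using LIM_zero_iff tendsto_norm_zero_iff by blast
  define K where "K = norm v + 1"
  have K: "K > 0" "\<forall>\<^sub>F s in at 0. norm (q s) < K"
    using order_tendstoD(2)[OF tendsto_norm[OF q], of K] by (auto simp: K_def add_nonneg_pos)
  have "((\<lambda>s. q s - D (w s)) \<longlongrightarrow> 0) (at 0)"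
  proof (rule tendstoI)
    fix \<delta> :: real assume "\<delta> > 0"
    \<comment> \<open>The bound \<open>B/2\<close> allows the error to be absorbed in \<open>norm (D (w s))\<close>, and the other one
      makes the resulting error at most \<open>\<delta> / 2\<close>.\<close>
    define e where "e = min (B/2) (\<delta> * B / (4 * K))"
    have e: "e > 0" "e \<le> B/2" "e \<le> \<delta> * B / (4 * K)"
      using \<open>\<delta> > 0\<close> B K by (auto simp: e_def)
    obtain d where d: "d > 0"
      "\<And>y. norm (y - u 0) < d \<Longrightarrow> norm (\<phi> y - \<phi> (u 0) - D (y - u 0)) \<le> e * norm (y - u 0)"
      using \<phi> e(1) unfolding has_derivative_at_alt by blast
    have "(u \<longlongrightarrow> u 0) (at 0)"
      using u by (simp add: isCont_def)
    then have "\<forall>\<^sub>F s in at 0. norm (u s - u 0) < d"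
      using d(1) by (simp add: tendsto_iff dist_norm)
    moreover have "\<forall>\<^sub>F s in at 0. \<gamma> s = \<phi> (u s)"
      using eq by (simp add: eventually_nhds_conv_at)
    moreover have "\<forall>\<^sub>F s in at (0::real). s \<noteq> 0"
      by (simp add: eventually_at_filter)
    ultimately show "\<forall>\<^sub>F s in at 0. dist (q s - D (w s)) 0 < \<delta>"
      using K(2)
    proof eventually_elim
      case (elim s)
      have "q s - D (w s) = (1/s) *\<^sub>R (\<phi> (u s) - \<phi> (u 0) - D (u s - u 0))"
        using elim(2) \<gamma>0 unfolding q_def w_def linear_scale[OF D(2)] by (simp add: scaleR_diff_right)
      then have "norm (q s - D (w s)) = norm (\<phi> (u s) - \<phi> (u 0) - D (u s - u 0)) / \<bar>s\<bar>"
        by simp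
      also have "\<dots> \<le> e * norm (u s - u 0) / \<bar>s\<bar>"
        using d(2)[OF elim(1)] by (simp add: divide_right_mono)
      also have "\<dots> = e * norm (w s)"
        by (simp add: w_def)
      finally have le: "norm (q s - D (w s)) \<le> e * norm (w s)" .
      also have "\<dots> \<le> B/2 * norm (w s)"
        using e(2) by (rule mult_right_mono) simp
      finally have "norm (D (w s)) \<le> norm (q s) + B/2 * norm (w s)"
        using norm_triangle_sub[of "D (w s)" "q s"] by (simp add: norm_minus_commute)
      then have w: "norm (w s) \<le> 2 * norm (q s) / B"
        using B(2)[of "w s"] B(1) by (simp add: field_simps)
      have "e * norm (w s) \<le> (\<delta> * B / (4 * K)) * (2 * K / B)"
      proof (rule mult_mono)
        show "norm (w s) \<le> 2 * K / B"
          using w elim(4) B(1) by (meson divide_right_mono less_imp_le mult_left_mono order.trans zero_le_numeral)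
      qed (use e \<open>\<delta> > 0\<close> B(1) K(1) in auto)
      also have "\<dots> < \<delta>"
        using B(1) K(1) \<open>\<delta> > 0\<close> by simp
      finally show ?case
        using le by simp
    qed
  qed
  then have "((\<lambda>s. D (w s)) \<longlongrightarrow> v) (at 0)"
    using tendsto_diff[OF q] by fastforce
  moreover have "closed (range D)"
    using D(2) by (simp add: closed_subspace linear_subspace_image)
  ultimately show ?thesis
    by (rule Lim_in_closed_set[of "range D" "\<lambda>s. D (w s)" "at 0" v, rotated 3]) (simp_all add: always_eventually)
qed

section \<open>Surfaces with a nondegenerate chart\<close>

lemma fubini_study_zero_left: "fubini_study x 0 w = 0"
  by (cases x) (simp add: fubini_study_def omega_def wedge_def dx1_def dx2_def dx1_bar_def dx2_bar_def)

text \<open>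
  For a complex parameter it is enough to pair the image of each direction \<open>h\<close> with the image of
  \<open>\<i> * h\<close>. A nonzero pairing also shows that the derivative has no kernel, so that the charts are
  immersions and every tangent vector is the image of some \<open>h\<close>; the partner demanded by the definition
  is the image of \<open>\<i> * h\<close>, realized by a straight line in the parameter domain.
\<close>

lemma symplectic_surface_if_charts:
  assumes charts: "\<And>p. p \<in> M \<Longrightarrow> \<exists>V W (\<Phi> :: complex \<Rightarrow> complex \<times> complex) \<psi> D \<F>.
      open V \<and> p \<in> V \<and> open W \<and> homeomorphism W (M \<inter> V) \<Phi> \<psi> \<and> deriv_closed W \<F> \<and> \<Phi> \<in> \<F>
      \<and> (\<forall>z\<in>W. (\<Phi> has_derivative D z) (at z))
      \<and> (\<forall>z\<in>W. \<forall>h. h \<noteq> 0 \<longrightarrow> fubini_study (\<Phi> z) (D z h) (D z (\<i> * h)) \<noteq> 0)"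
  shows "symplectic_surface M"
  unfolding symplectic_surface_def smooth_surface_def
proof (intro conjI ballI impI)
  let ?Z = "\<lambda>u. Complex (fst u) (snd u)"
  let ?R = "\<lambda>z. (Re z, Im z)"
  have Z_eq: "?Z = (\<lambda>u. of_real (fst u) + \<i> * of_real (snd u))"
    by (simp add: complex_eq_iff fun_eq_iff)
  have Z: "(?Z has_derivative ?Z) (at u)" for u
    unfolding Z_eq by (rule bounded_linear_imp_has_derivative)
      (intro bounded_linear_add bounded_linear_compose[OF bounded_linear_of_real]
        bounded_linear_compose[OF bounded_linear_mult_right] bounded_linear_fst bounded_linear_snd)
  have contZ: "continuous_on A ?Z" for A
    by (rule continuous_at_imp_continuous_on) (blast intro: has_derivative_continuous Z)
  have inj: "inj (D z)" if D: "(\<Phi> has_derivative D z) (at z)"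
    "\<forall>h. h \<noteq> 0 \<longrightarrow> fubini_study (\<Phi> z) (D z h) (D z (\<i> * h)) \<noteq> 0"
    for \<Phi> :: "complex \<Rightarrow> complex \<times> complex" and D z
    using D has_derivative_linear[OF D(1)] by (metis fubini_study_zero_left linear_injective_0)
  fix p assume "p \<in> M"
  then obtain V W \<Phi> \<psi> D \<F> where VW: "open V" "p \<in> V" "open W"
    and hom: "homeomorphism W (M \<inter> V) \<Phi> \<psi>"
    and smooth: "deriv_closed W \<F>" "\<Phi> \<in> \<F>"
    and "\<forall>z\<in>W. (\<Phi> has_derivative D z) (at z)"
    and "\<forall>z\<in>W. \<forall>h. h \<noteq> 0 \<longrightarrow> fubini_study (\<Phi> z) (D z h) (D z (\<i> * h)) \<noteq> 0"
    using charts[OF \<open>p \<in> M\<close>] by (elim exE conjE) (rule that; assumption)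
  then have D: "\<And>z. z \<in> W \<Longrightarrow> (\<Phi> has_derivative D z) (at z)"
    and nondeg: "\<And>z h. z \<in> W \<Longrightarrow> h \<noteq> 0 \<Longrightarrow> fubini_study (\<Phi> z) (D z h) (D z (\<i> * h)) \<noteq> 0"
    by simp_all
  show "\<exists>V U (\<phi> :: real \<times> real \<Rightarrow> complex \<times> complex) \<psi>.
        open V \<and> p \<in> V \<and> open U \<and> homeomorphism U (M \<inter> V) \<phi> \<psi> \<and> smooth_on U \<phi>
        \<and> (\<forall>u\<in>U. inj (frechet_derivative \<phi> (at u)))"
  proof (intro exI conjI ballI)
    show "open (?Z -` W)"
      using VW(3) by (rule open_vimage) (rule contZ)
    have "homeomorphism (?Z -` W) W ?Z ?R"
      by (rule homeomorphismI) (auto intro!: contZ continuous_intros)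
    then show "homeomorphism (?Z -` W) (M \<inter> V) (\<Phi> \<circ> ?Z) (?R \<circ> \<psi>)"
      using hom by (rule homeomorphism_compose)
    have "smooth_on (?Z -` W) (\<lambda>u. \<Phi> (?Z u))"
      by (rule smooth_on_compose_affine[OF smooth Z]) auto
    then show "smooth_on (?Z -` W) (\<Phi> \<circ> ?Z)"
      by (simp add: o_def)
    fix u assume u: "u \<in> ?Z -` W"
    have "(\<Phi> \<circ> ?Z has_derivative D (?Z u) \<circ> ?Z) (at u)"
      using u by (intro diff_chain_at Z D) auto
    then have "frechet_derivative (\<Phi> \<circ> ?Z) (at u) = D (?Z u) \<circ> ?Z"
      by (rule frechet_derivative_at[symmetric])
    moreover have "inj (D (?Z u))"
      using u nondeg by (intro inj[OF D]) auto
    moreover have "inj ?Z"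
      by (rule injI) (auto simp: prod_eq_iff)
    ultimately show "inj (frechet_derivative (\<Phi> \<circ> ?Z) (at u))"
      by (simp add: inj_compose)
  qed fact+
  fix v assume "v \<in> tangent_space M p" "v \<noteq> 0"
  define z where "z = \<psi> p"
  have z: "z \<in> W" "\<Phi> z = p"
    using hom \<open>p \<in> M\<close> \<open>p \<in> V\<close> by (auto simp: z_def homeomorphism_def)
  have "v \<in> range (D z)"
  proof -
    obtain \<epsilon> \<gamma> where \<gamma>: "\<epsilon> > 0" "smooth_on {-\<epsilon><..<\<epsilon>} \<gamma>" "\<gamma> ` {-\<epsilon><..<\<epsilon>} \<subseteq> M" "\<gamma> 0 = p"
      "(\<gamma> has_vector_derivative v) (at 0)"
      using \<open>v \<in> tangent_space M p\<close> unfolding tangent_space_def by blast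
    have "C_diff 0 {-\<epsilon><..<\<epsilon>} \<gamma>"
      using \<gamma>(2) unfolding smooth_on_def by blast
    then have cont: "continuous_on {-\<epsilon><..<\<epsilon>} \<gamma>"
      by simp
    define I where "I = {-\<epsilon><..<\<epsilon>} \<inter> \<gamma> -` V"
    have I: "open I" "0 \<in> I"
      using \<gamma>(1,4) VW(1,2) by (auto simp: I_def intro!: continuous_open_preimage[OF cont])
    have \<gamma>I: "\<gamma> ` I \<subseteq> M \<inter> V"
      using \<gamma>(3) by (auto simp: I_def)
    have "continuous_on I \<gamma>"
      by (rule continuous_on_subset[OF cont]) (simp add: I_def)
    then have "continuous_on I (\<lambda>s. \<psi> (\<gamma> s))"
      using homeomorphism_cont2[OF hom] \<gamma>I by (intro continuous_on_compose2[of "M \<inter> V" \<psi> I \<gamma>])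
    then have "isCont (\<lambda>s. \<psi> (\<gamma> s)) 0"
      using I continuous_on_eq_continuous_at by blast
    moreover have "\<forall>\<^sub>F s in nhds 0. \<gamma> s = \<Phi> (\<psi> (\<gamma> s))"
    proof (rule eventually_nhds[THEN iffD2], intro exI conjI ballI)
      fix s assume "s \<in> I"
      then have "\<gamma> s \<in> M \<inter> V"
        using \<gamma>I by blast
      then show "\<gamma> s = \<Phi> (\<psi> (\<gamma> s))"
        by (simp add: homeomorphism_apply2[OF hom])
    qed (fact I)+
    moreover have "(\<Phi> has_derivative D z) (at (\<psi> (\<gamma> 0)))" "inj (D z)"
      using D[OF z(1)] nondeg[OF z(1)] inj by (simp_all add: \<gamma>(4) z_def)
    ultimately show ?thesis
      using velocity_in_range_derivative[of \<Phi> "D z" "\<lambda>s. \<psi> (\<gamma> s)" \<gamma> v] \<gamma>(5) by blast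
  qed
  then obtain h where h: "v = D z h" "h \<noteq> 0"
    using \<open>v \<noteq> 0\<close> linear_0[OF has_derivative_linear[OF D[OF z(1)]]] by blast
  have "D z (\<i> * h) \<in> tangent_space M p"
  proof -
    let ?l = "\<lambda>s::real. z + of_real s * (\<i> * h)"
    have l: "(?l has_derivative (\<lambda>s. of_real s * (\<i> * h))) (at s)" for s
      by (auto intro!: derivative_eq_intros)
    have "open (?l -` W)"
      using VW(3) by (rule open_vimage) (intro continuous_intros)
    then obtain \<epsilon> where "\<epsilon> > 0" "ball 0 \<epsilon> \<subseteq> ?l -` W"
      using z(1) by (auto elim: openE[of _ 0])
    then have \<epsilon>: "\<epsilon> > 0" "\<And>s. \<bar>s\<bar> < \<epsilon> \<Longrightarrow> ?l s \<in> W"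
      by (auto simp: subset_iff)
    have "smooth_on {-\<epsilon><..<\<epsilon>} (\<lambda>s. \<Phi> (?l s))"
      using \<epsilon>(2) by (intro smooth_on_compose_affine[OF smooth l]) auto
    moreover have "(\<lambda>s. \<Phi> (?l s)) ` {-\<epsilon><..<\<epsilon>} \<subseteq> M"
    proof (rule image_subsetI)
      fix s assume "s \<in> {-\<epsilon><..<\<epsilon>}"
      then have "?l s \<in> W"
        by (intro \<epsilon>(2)) auto
      then show "\<Phi> (?l s) \<in> M"
        using homeomorphism_image1[OF hom] by blast
    qed
    moreover have "((\<lambda>s. \<Phi> (?l s)) has_vector_derivative D z (\<i> * h)) (at 0)"
    proof -
      have "(\<Phi> has_derivative D z) (at (?l 0))"
        using D[OF z(1)] by simp
      then have "((\<lambda>s. \<Phi> (?l s)) has_derivative (\<lambda>s. D z (of_real s * (\<i> * h)))) (at 0)"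
        by (rule has_derivative_compose[OF l])
      moreover have "D z (of_real s * (\<i> * h)) = s *\<^sub>R D z (\<i> * h)" for s
        using linear_scale[OF has_derivative_linear[OF D[OF z(1)]], of s "\<i> * h"]
        by (simp add: scaleR_conv_of_real)
      ultimately show ?thesis
        by (simp add: has_vector_derivative_def)
    qed
    ultimately show ?thesis
      using \<epsilon>(1) z(2) unfolding tangent_space_def
      by (intro CollectI exI[of _ \<epsilon>] conjI exI[of _ "\<lambda>s. \<Phi> (?l s)"]) auto
  qed
  moreover have "fubini_study p v (D z (\<i> * h)) \<noteq> 0"
    using nondeg[OF z(1) h(2)] by (simp add: h(1) z(2))
  ultimately show "\<exists>w\<in>tangent_space M p. fubini_study p v w \<noteq> 0"
    by blast
qed

section \<open>The pulled back Fubini-Study form\<close>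

text \<open>
  A tangent vector is written as \<open>(y\<^sub>1 p\<^sub>1, y\<^sub>2 p\<^sub>2)\<close>, where \<open>p\<^sub>k\<close> is the value of the logarithmic
  differential \<open>d\<zeta>\<^sub>k = dy\<^sub>k / y\<^sub>k\<close> on it. Then \<open>Im (cnj p\<^sub>k * q\<^sub>k)\<close> is the value of \<open>d\<rho>\<^sub>k \<and> d\<theta>\<^sub>k\<close>,
  and the mixed term is that of \<open>d\<rho>\<^sub>1 \<and> d\<theta>\<^sub>2 + d\<rho>\<^sub>2 \<and> d\<theta>\<^sub>1\<close>.
\<close>

lemma fubini_study_logarithmic:
  "fubini_study (y1, y2) (y1 * p1, y2 * p2) (y1 * q1, y2 * q2) =
     2 / (1 + (cmod y1)\<^sup>2 + (cmod y2)\<^sup>2)\<^sup>2 *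
     ((cmod y1)\<^sup>2 * (1 + (cmod y2)\<^sup>2) * Im (cnj p1 * q1)
      - (cmod y1)\<^sup>2 * (cmod y2)\<^sup>2 * (Im (cnj p1 * q2) + Im (cnj p2 * q1))
      + (cmod y2)\<^sup>2 * (1 + (cmod y1)\<^sup>2) * Im (cnj p2 * q2))"
proof -
  have "omega (y1, y2) (y1 * p1, y2 * p2) (y1 * q1, y2 * q2) =
    ((y1 * cnj y1) * (1 + y2 * cnj y2) * (p1 * cnj q1 - q1 * cnj p1)
     - (y1 * cnj y1) * (y2 * cnj y2) * ((p1 * cnj q2 - q2 * cnj p1) + (p2 * cnj q1 - q1 * cnj p2))
     + (y2 * cnj y2) * (1 + y1 * cnj y1) * (p2 * cnj q2 - q2 * cnj p2))
    / of_real ((1 + (cmod y1)\<^sup>2 + (cmod y2)\<^sup>2)\<^sup>2)"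
    unfolding omega_def prod.case wedge_def dx1_def dx2_def dx1_bar_def dx2_bar_def fst_conv snd_conv complex_norm_square
    by (rule arg_cong2[where f = "(/)"]) (simp_all add: algebra_simps)
  then show ?thesis
    unfolding fubini_study_def complex_norm_square[symmetric]
    by (simp add: Re_divide_of_real flip: of_real_mult of_real_add) (simp add: field_simps)
qed

text \<open>
  Here \<open>(a, b; c, d)\<close> is the matrix acting on the logarithms of the moduli, \<open>R\<^sub>k = \<bar>X\<^sub>k\<bar>\<close>,
  \<open>w\<^sub>k\<close> is the squared modulus of the \<open>k\<close>-th coordinate of the image point, and \<open>q\<close> equals
  \<open>- Re (X\<^sub>1 * cnj X\<^sub>2)\<close> on the line \<open>X\<^sub>1 + X\<^sub>2 = -1\<close>.
\<close>

definition pullback_density :: "real \<Rightarrow> real \<Rightarrow> real \<Rightarrow> real \<Rightarrow> real \<Rightarrow> real \<Rightarrow> real \<Rightarrow> real \<Rightarrow> real" where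
  "pullback_density a b c d R1 R2 w1 w2 = (let q = (R1\<^sup>2 + R2\<^sup>2 - 1) / 2 in
     w1 * (1 + w2) * (a * R2\<^sup>2 + b * q)
     - w1 * w2 * (a * q + b * R1\<^sup>2 + c * R2\<^sup>2 + d * q)
     + w2 * (1 + w1) * (c * q + d * R1\<^sup>2))"

text \<open>
  The logarithmic differentials \<open>u\<^sub>1 = - X\<^sub>2 * \<tau>\<close> and \<open>u\<^sub>2 = X\<^sub>1 * \<tau>\<close> are those of a line
  \<open>X\<^sub>1 + X\<^sub>2 = -1\<close>, since \<open>X\<^sub>1 * u\<^sub>1 + X\<^sub>2 * u\<^sub>2 = 0\<close>. The matrix \<open>(a, b; c, d)\<close> acts on their real
  parts and leaves the imaginary parts alone. Every term of the form becomes a combination of \<open>\<bar>u\<^sub>1\<bar>\<^sup>2\<close>,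
  \<open>\<bar>u\<^sub>2\<bar>\<^sup>2\<close> and \<open>Re (u\<^sub>1 * cnj u\<^sub>2)\<close>, and the last of these is \<open>q * \<bar>\<tau>\<bar>\<^sup>2\<close> because
  \<open>\<bar>X\<^sub>1 + X\<^sub>2\<bar>\<^sup>2 = 1\<close>.
\<close>

lemma fubini_study_pullback_line:
  fixes X1 X2 \<tau> :: complex and a b c d :: real
  defines "P \<equiv> \<lambda>\<tau>. (Complex (a * Re (- X2 * \<tau>) + b * Re (X1 * \<tau>)) (Im (- X2 * \<tau>)),
                      Complex (c * Re (- X2 * \<tau>) + d * Re (X1 * \<tau>)) (Im (X1 * \<tau>)))"
  assumes line: "X1 + X2 = -1"
  shows "fubini_study (y1, y2) (y1 * fst (P \<tau>), y2 * snd (P \<tau>)) (y1 * fst (P (\<i> * \<tau>)), y2 * snd (P (\<i> * \<tau>))) =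
     2 * (cmod \<tau>)\<^sup>2 / (1 + (cmod y1)\<^sup>2 + (cmod y2)\<^sup>2)\<^sup>2
     * pullback_density a b c d (cmod X1) (cmod X2) ((cmod y1)\<^sup>2) ((cmod y2)\<^sup>2)"
proof -
  define u1 u2 where "u1 = - X2 * \<tau>" and "u2 = X1 * \<tau>"
  define q where "q = ((cmod X1)\<^sup>2 + (cmod X2)\<^sup>2 - 1) / 2"
  have X2: "Re X2 = - 1 - Re X1" "Im X2 = - Im X1"
    using line by (auto simp: complex_eq_iff)
  have u: "(cmod u1)\<^sup>2 = (cmod X2)\<^sup>2 * (cmod \<tau>)\<^sup>2" "(cmod u2)\<^sup>2 = (cmod X1)\<^sup>2 * (cmod \<tau>)\<^sup>2"
    by (simp_all add: u1_def u2_def norm_mult power_mult_distrib)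
  have "Re (u1 * cnj u2) = - Re (X2 * cnj X1) * (cmod \<tau>)\<^sup>2"
    unfolding cmod_power2 by (simp add: u1_def u2_def) algebra
  also have "- Re (X2 * cnj X1) = q"
    unfolding q_def cmod_power2 X2 by (simp add: X2 power2_eq_square field_simps)
  finally have uq: "Re (u1 * cnj u2) = q * (cmod \<tau>)\<^sup>2" .
  have P: "fst (P \<tau>) = Complex (a * Re u1 + b * Re u2) (Im u1)"
    "snd (P \<tau>) = Complex (c * Re u1 + d * Re u2) (Im u2)"
    "fst (P (\<i> * \<tau>)) = Complex (- (a * Im u1 + b * Im u2)) (Re u1)"
    "snd (P (\<i> * \<tau>)) = Complex (- (c * Im u1 + d * Im u2)) (Re u2)"
    by (simp_all add: P_def u1_def u2_def complex_eq_iff algebra_simps)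
  have 1: "Im (cnj (fst (P \<tau>)) * fst (P (\<i> * \<tau>))) = a * (cmod u1)\<^sup>2 + b * Re (u1 * cnj u2)"
    and 2: "Im (cnj (snd (P \<tau>)) * snd (P (\<i> * \<tau>))) = c * Re (u1 * cnj u2) + d * (cmod u2)\<^sup>2"
    and 3: "Im (cnj (fst (P \<tau>)) * snd (P (\<i> * \<tau>))) + Im (cnj (snd (P \<tau>)) * fst (P (\<i> * \<tau>))) =
      a * Re (u1 * cnj u2) + b * (cmod u2)\<^sup>2 + c * (cmod u1)\<^sup>2 + d * Re (u1 * cnj u2)"
    unfolding P cmod_power2 by (simp_all add: power2_eq_square algebra_simps)
  show ?thesis
    unfolding fubini_study_logarithmic 1 2 3 u uq pullback_density_def Let_def q_def[symmetric]
    by (simp add: field_simps)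
qed

lemma pullback_density_swap:
  "pullback_density a b c d R1 R2 w1 w2 = pullback_density d c b a R2 R1 w2 w1"
  by (simp add: pullback_density_def Let_def algebra_simps)

text \<open>
  The names of the next three lemmas record the position of \<open>1\<close> among \<open>1, R\<^sub>1, R\<^sub>2\<close> when
  \<open>R\<^sub>2 < R\<^sub>1\<close>. In all of them the coefficient of \<open>w\<^sub>1 * w\<^sub>2\<close> is simplified by
  \<open>R\<^sub>1\<^sup>2 + R\<^sub>2\<^sup>2 - 2 * q = 1\<close>. In the present case the remaining sign is that of \<open>R\<^sub>1\<^sup>2 - t * q\<close>, which is
  nonnegative because \<open>2 * q < R\<^sub>1\<^sup>2\<close>.
\<close>

lemma pullback_density_pos_1_max:
  assumes "0 \<le> t" "t \<le> 1" "0 < w1" "0 < w2" "R2 < R1" "R1 < 1" "0 < R2"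
  shows "pullback_density (1 - t) 0 (- t) 1 R1 R2 w1 w2 > 0"
proof -
  define q where "q = (R1\<^sup>2 + R2\<^sup>2 - 1) / 2"
  have "R1\<^sup>2 < 1" "R2\<^sup>2 < R1\<^sup>2"
    using assms by (simp_all add: abs_square_less_1 power_strict_mono)
  then have "q < R1\<^sup>2"
    by (simp add: q_def)
  then have "t * q \<le> R1\<^sup>2"
    using assms(1,2) by (metis less_imp_le mult_left_le_one_le mult_nonneg_nonpos not_le order.trans zero_le_power2)
  have "pullback_density (1 - t) 0 (- t) 1 R1 R2 w1 w2 =
    (1 - t) * (w1 * R2\<^sup>2) + w1 * w2 + w2 * (R1\<^sup>2 - t * q)"
    unfolding pullback_density_def Let_def q_def by (simp add: field_simps)
  moreover have "(1 - t) * (w1 * R2\<^sup>2) \<ge> 0" "w1 * w2 > 0" "w2 * (R1\<^sup>2 - t * q) \<ge> 0"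
    using assms \<open>t * q \<le> R1\<^sup>2\<close> by simp_all
  ultimately show ?thesis
    by linarith
qed

text \<open>
  The coefficient of \<open>w\<^sub>1 * w\<^sub>2\<close> is \<open>1 + t * (q - R\<^sub>2\<^sup>2)\<close>, and \<open>R\<^sub>2 < R\<^sub>1\<close> keeps it at least
  \<open>1 - t / 2\<close>.
\<close>

lemma pullback_density_pos_1_mid:
  assumes "0 \<le> t" "t \<le> 1" "0 < w1" "0 < w2" "0 < R2" "R2 < 1" "1 < R1"
  shows "pullback_density (1 - t) 0 0 1 R1 R2 w1 w2 > 0"
proof -
  have "R2\<^sup>2 < R1\<^sup>2"
    using assms by (simp add: power_strict_mono)
  then have "t * (R1\<^sup>2 - R2\<^sup>2 - 1) \<ge> t * (- 1)"
    using assms by (intro mult_left_mono) auto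
  then have "1 + t * (R1\<^sup>2 - R2\<^sup>2 - 1) / 2 > 0"
    using assms by linarith
  moreover have "pullback_density (1 - t) 0 0 1 R1 R2 w1 w2 =
    (1 - t) * (w1 * R2\<^sup>2) + w1 * w2 * (1 + t * (R1\<^sup>2 - R2\<^sup>2 - 1) / 2) + w2 * R1\<^sup>2"
    unfolding pullback_density_def Let_def by (simp add: field_simps)
  moreover have "(1 - t) * (w1 * R2\<^sup>2) \<ge> 0" "w2 * R1\<^sup>2 > 0"
    using assms by simp_all
  ultimately show ?thesis
    using assms by (simp add: add_nonneg_pos add_pos_pos)
qed

text \<open>
  The coefficient of \<open>w\<^sub>1 * w\<^sub>2\<close> is \<open>1 - t\<close>, and \<open>q\<close> is positive as both \<open>R\<^sub>1\<close> and \<open>R\<^sub>2\<close>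
  exceed \<open>1\<close>.
\<close>

lemma pullback_density_pos_1_min:
  assumes "0 \<le> t" "t \<le> 1" "0 < w1" "0 < w2" "1 < R2" "R2 < R1"
  shows "pullback_density (1 - t) t 0 1 R1 R2 w1 w2 > 0"
proof -
  define q where "q = (R1\<^sup>2 + R2\<^sup>2 - 1) / 2"
  have "1 < R1\<^sup>2" "0 < R2\<^sup>2"
    using assms by simp_all
  then have "1 + 0 < R1\<^sup>2 + R2\<^sup>2"
    by (rule add_strict_mono)
  then have "q > 0"
    by (simp add: q_def)
  have "pullback_density (1 - t) t 0 1 R1 R2 w1 w2 =
    w1 * ((1 - t) * R2\<^sup>2 + t * q) + w2 * R1\<^sup>2 + (1 - t) * (w1 * w2)"
    unfolding pullback_density_def Let_def q_def by (simp add: field_simps)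
  moreover have "w1 * ((1 - t) * R2\<^sup>2 + t * q) \<ge> 0" "w2 * R1\<^sup>2 > 0" "(1 - t) * (w1 * w2) \<ge> 0"
    using assms \<open>q > 0\<close> by simp_all
  ultimately show ?thesis
    by linarith
qed

section \<open>The deformation maps the curve homeomorphically\<close>

text \<open>
  The factor of a coordinate of modulus \<open>r\<close> when the other coordinate has modulus \<open>s\<close>.
\<close>

definition stretch :: "real \<Rightarrow> real \<Rightarrow> real \<Rightarrow> real" where
  "stretch t r s = (max 1 s / max r s) powr t"

lemma F_eq_stretch:
  "F t (x1, x2) = (of_real (stretch t (cmod x1) (cmod x2)) * x1, of_real (stretch t (cmod x2) (cmod x1)) * x2)"
  by (simp add: F_def stretch_def Let_def max.commute)

lemma stretch_pos: "0 < r \<or> 0 < s \<Longrightarrow> 0 < stretch t r s"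
  by (auto simp: stretch_def less_max_iff_disj)

lemma stretch_eq_1: "1 \<le> s \<Longrightarrow> r \<le> s \<Longrightarrow> stretch t r s = 1"
  by (simp add: stretch_def max_absorb2)

lemma stretch_commute: "r \<le> 1 \<Longrightarrow> s \<le> 1 \<Longrightarrow> stretch t r s = stretch t s r"
  by (simp add: stretch_def max_absorb1 max.commute)

lemma S0_swap: "(x1, x2) \<in> S0 \<Longrightarrow> (x2, x1) \<in> S0"
  by (simp add: S0_def add.commute)

lemma S0_nonzero: "(x1, x2) \<in> S0 \<Longrightarrow> x1 \<noteq> 0 \<or> x2 \<noteq> 0"
  by (auto simp: S0_def)

lemma S0_norm_le:
  assumes "(x1, x2) \<in> S0"
  shows "cmod x1 \<le> 2 * max 1 (cmod x2)"
proof -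
  let ?m = "max 1 (cmod x2)"
  have "x1 ^ 5 = - (1 + x2 ^ 5)"
    using assms by (auto simp: S0_def algebra_simps eq_neg_iff_add_eq_0)
  then have "cmod x1 ^ 5 = cmod (1 + x2 ^ 5)"
    by (metis norm_minus_cancel norm_power)
  also have "\<dots> \<le> 1 + cmod x2 ^ 5"
    using norm_triangle_ineq[of 1 "x2 ^ 5"] by (simp add: norm_power)
  also have "\<dots> \<le> ?m ^ 5 + ?m ^ 5"
    by (intro add_mono power_mono) auto
  also have "\<dots> \<le> (2 * ?m) ^ 5"
    by (simp add: power_mult_distrib)
  finally show ?thesis
    by (rule power_le_imp_le_base[of _ 4, simplified]) auto
qed

text \<open>
  On the curve each of \<open>1, r\<^sub>1, r\<^sub>2\<close> is at most twice the larger of the other two. This bounds the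
  factors from below and thereby makes \<^term>\<open>F t\<close> proper on the curve.
\<close>

lemma stretch_ge_half:
  assumes "(x1, x2) \<in> S0" "0 \<le> t" "t \<le> 1"
  shows "1 / 2 \<le> stretch t (cmod x1) (cmod x2)"
proof -
  have "0 < max (cmod x1) (cmod x2)"
    using S0_nonzero[OF assms(1)] by (auto simp: less_max_iff_disj)
  moreover have "max (cmod x1) (cmod x2) \<le> 2 * max 1 (cmod x2)"
    using S0_norm_le[OF assms(1)] by auto
  ultimately have "1 / 2 \<le> max 1 (cmod x2) / max (cmod x1) (cmod x2)"
    by (simp add: field_simps)
  then have "(1 / 2) powr t \<le> stretch t (cmod x1) (cmod x2)"
    unfolding stretch_def using assms(2) by (intro powr_mono2) auto
  moreover have "(1 / 2 :: real) powr 1 \<le> (1 / 2) powr t"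
    using assms(3) by (intro powr_mono') auto
  ultimately show ?thesis
    by simp
qed

lemma norm_le_norm_F:
  assumes "x \<in> S0" "0 \<le> t" "t \<le> 1"
  shows "norm x \<le> 2 * norm (F t x)"
proof (cases x)
  case (Pair x1 x2)
  have le: "cmod x1 \<le> cmod (2 * (of_real (stretch t (cmod x1) (cmod x2)) * x1))"
    if "(x1, x2) \<in> S0" for x1 x2
  proof -
    have "1 * cmod x1 \<le> (2 * stretch t (cmod x1) (cmod x2)) * cmod x1"
      using stretch_ge_half[OF that assms(2,3)] by (intro mult_right_mono) auto
    then show ?thesis
      using stretch_ge_half[OF that assms(2,3)] by (simp add: norm_mult)
  qed
  have "norm x \<le> norm (2 *\<^sub>R F t x)"
    unfolding Pair F_eq_stretch scaleR_Pair norm_Pair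
    using assms(1) le[of x1 x2] le[of x2 x1] S0_swap
    by (intro real_sqrt_le_mono add_mono power_mono) (auto simp: Pair scaleR_conv_of_real)
  then show ?thesis
    by simp
qed

lemma continuous_on_F: "continuous_on S0 (F t)"
proof -
  have pos: "max (cmod (fst x)) (cmod (snd x)) > 0" "max (cmod (snd x)) (cmod (fst x)) > 0" if "x \<in> S0" for x
    using S0_nonzero[of "fst x" "snd x"] that by (auto simp: less_max_iff_disj)
  have "continuous_on S0 (\<lambda>x. stretch t (cmod (fst x)) (cmod (snd x)))"
       "continuous_on S0 (\<lambda>x. stretch t (cmod (snd x)) (cmod (fst x)))"
    unfolding stretch_def using pos by (intro continuous_intros ballI; force)+
  then have "continuous_on S0 (\<lambda>x. (of_real (stretch t (cmod (fst x)) (cmod (snd x))) * fst x,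
      of_real (stretch t (cmod (snd x)) (cmod (fst x))) * snd x))"
    by (intro continuous_intros)
  then show ?thesis
    by (rule continuous_on_eq) (auto simp: F_eq_stretch)
qed

text \<open>
  The points of the curve with real \<open>X\<^sub>1, X\<^sub>2\<close> form three kinds of arcs according to the signs.
  If neither is positive, both moduli are at most \<open>1\<close>; if one is positive, the other coordinate has the
  largest modulus and that modulus exceeds \<open>1\<close>.
\<close>

lemma stretch_real_point:
  assumes "(x1, x2) \<in> S0" "Im (x1 ^ 5) = 0"
  shows "Re (x1 ^ 5) \<le> 0 \<Longrightarrow> Re (x2 ^ 5) \<le> 0 \<Longrightarrow> stretch t (cmod x1) (cmod x2) = stretch t (cmod x2) (cmod x1)"
    and "Re (x1 ^ 5) > 0 \<Longrightarrow> stretch t (cmod x1) (cmod x2) = 1"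
    and "Re (x2 ^ 5) > 0 \<Longrightarrow> stretch t (cmod x2) (cmod x1) = 1"
proof -
  have sum: "Re (x1 ^ 5) + Re (x2 ^ 5) = - 1" and im: "Im (x2 ^ 5) = 0"
    using assms by (auto simp: S0_def complex_eq_iff)
  have R: "cmod x1 ^ 5 = \<bar>Re (x1 ^ 5)\<bar>" "cmod x2 ^ 5 = \<bar>Re (x2 ^ 5)\<bar>"
    using assms(2) im by (simp_all add: cmod_eq_Re flip: norm_power)
  have le: "r \<le> s" if "r ^ 5 \<le> s ^ 5" "0 \<le> s" for r s :: real
    using that by (rule power_le_imp_le_base[of _ 4, simplified])
  have le1: "r \<le> 1" if "r ^ 5 \<le> 1" for r :: real
    using le[of r 1] that by simp
  have ge1: "1 \<le> s" if "1 \<le> s ^ 5" "0 \<le> s" for s :: real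
    using le[of 1 s] that by simp
  show "stretch t (cmod x1) (cmod x2) = stretch t (cmod x2) (cmod x1)"
    if "Re (x1 ^ 5) \<le> 0" "Re (x2 ^ 5) \<le> 0"
    using that sum by (intro stretch_commute le1[of "cmod x1"] le1[of "cmod x2"]) (simp_all add: R)
  show "stretch t (cmod x1) (cmod x2) = 1" if "Re (x1 ^ 5) > 0"
    using that sum by (intro stretch_eq_1 le[of "cmod x1" "cmod x2"] ge1[of "cmod x2"]) (simp_all add: R)
  show "stretch t (cmod x2) (cmod x1) = 1" if "Re (x2 ^ 5) > 0"
    using that sum by (intro stretch_eq_1 le[of "cmod x2" "cmod x1"] ge1[of "cmod x1"]) (simp_all add: R)
qed

text \<open>
  Two points with the same image differ by positive factors \<open>s\<^sub>1, s\<^sub>2\<close>, and both satisfy the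
  equation, so \<open>X\<^sub>1 + X\<^sub>2 = -1\<close> and \<open>s\<^sub>1\<^sup>5 * X\<^sub>1 + s\<^sub>2\<^sup>5 * X\<^sub>2 = -1\<close>. If \<open>X\<^sub>1\<close> is not real, comparing
  imaginary parts gives \<open>s\<^sub>1 = s\<^sub>2 = 1\<close>. For real \<open>X\<^sub>1\<close> the signs of \<open>X\<^sub>1, X\<^sub>2\<close> are the same at both
  points; either both coordinates are stretched by the same factor and again \<open>s\<^sub>1 = s\<^sub>2\<close>, or one
  coordinate is left alone and determines the point.
\<close>

lemma inj_on_F: "inj_on (F t) S0"
proof (rule inj_onI, clarify)
  fix x1 x2 x1' x2' assume x: "(x1, x2) \<in> S0" and x': "(x1', x2') \<in> S0"
    and eq: "F t (x1, x2) = F t (x1', x2')"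
  define l1 l2 l1' l2' where "l1 = stretch t (cmod x1) (cmod x2)" and "l2 = stretch t (cmod x2) (cmod x1)"
    and "l1' = stretch t (cmod x1') (cmod x2')" and "l2' = stretch t (cmod x2') (cmod x1')"
  note ldefs = l1_def l2_def l1'_def l2'_def
  have pos: "l1 > 0" "l2 > 0" "l1' > 0" "l2' > 0"
    using S0_nonzero[OF x] S0_nonzero[OF x'] by (auto simp: ldefs intro!: stretch_pos)
  define s1 s2 where "s1 = l1 / l1'" and "s2 = l2 / l2'"
  have s: "s1 > 0" "s2 > 0"
    using pos by (simp_all add: s1_def s2_def)
  have xs: "x1' = of_real s1 * x1" "x2' = of_real s2 * x2"
    using eq pos by (simp_all add: F_eq_stretch s1_def s2_def field_simps flip: ldefs)
  define a b where "a = x1 ^ 5" and "b = x2 ^ 5"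
  have ab: "a + b = - 1" "of_real (s1 ^ 5) * a + of_real (s2 ^ 5) * b = - 1"
    using x x' by (simp_all add: S0_def xs a_def b_def power_mult_distrib add_eq_0_iff2)
  have re: "Re a + Re b = - 1" "s1 ^ 5 * Re a + s2 ^ 5 * Re b = - 1"
    and im: "Im b = - Im a" "s1 ^ 5 * Im a + s2 ^ 5 * Im b = 0"
    using ab by (auto simp: complex_eq_iff simp flip: of_real_power)
  have root1: "s = 1" if "s ^ 5 = 1" "s > 0" for s :: real
    using that by (metis less_imp_le power_eq_1_iff abs_of_pos zero_neq_numeral real_norm_def)
  have same: "s1 = 1 \<and> s2 = 1" if "s1 ^ 5 = s2 ^ 5"
  proof -
    have "s1 ^ 5 * (Re a + Re b) = - 1"
      using re(2) that by (simp add: algebra_simps)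
    then show ?thesis
      using re(1) that s root1 by simp
  qed
  have "s1 = 1 \<and> s2 = 1"
  proof (cases "Im a = 0")
    case False
    have "(s1 ^ 5 - s2 ^ 5) * Im a = 0"
      using im by (simp add: algebra_simps)
    then show ?thesis
      using False same by simp
  next
    case True
    have real: "Im (x1 ^ 5) = 0" "Im (x1' ^ 5) = 0"
      using True by (simp_all add: a_def xs power_mult_distrib flip: of_real_power)
    have re': "Re (x1' ^ 5) = s1 ^ 5 * Re a" "Re (x2' ^ 5) = s2 ^ 5 * Re b"
      by (simp_all add: a_def b_def xs power_mult_distrib flip: of_real_power)
    consider "Re a \<le> 0" "Re b \<le> 0" | "Re a > 0" | "Re b > 0"
      by linarith
    then show ?thesis
    proof cases
      case 1
      have "Re (x1' ^ 5) \<le> 0" "Re (x2' ^ 5) \<le> 0"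
        unfolding re' using 1 s by (simp_all add: mult_nonneg_nonpos)
      then have "l1 = l2" "l1' = l2'"
        using 1 stretch_real_point(1)[OF x real(1)] stretch_real_point(1)[OF x' real(2)]
        by (simp_all add: ldefs a_def b_def)
      then show ?thesis
        by (intro same) (simp add: s1_def s2_def)
    next
      case 2
      have "Re (x1' ^ 5) > 0"
        unfolding re' using 2 s by simp
      then have "s1 = 1"
        using 2 stretch_real_point(2)[OF x real(1)] stretch_real_point(2)[OF x' real(2)]
        by (simp add: s1_def ldefs a_def)
      then have "s2 ^ 5 * Re b + Re a = - 1"
        using re(2) by simp
      then have "s2 ^ 5 * Re b = Re b"
        using re(1) by linarith
      then have "s2 ^ 5 = 1"
        using re 2 by simp
      then show ?thesis
        using root1 s \<open>s1 = 1\<close> by simp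
    next
      case 3
      have "Re (x2' ^ 5) > 0"
        unfolding re' using 3 s by simp
      then have "s2 = 1"
        using 3 stretch_real_point(3)[OF x real(1)] stretch_real_point(3)[OF x' real(2)]
        by (simp add: s2_def ldefs b_def)
      then have "s1 ^ 5 * Re a + Re b = - 1"
        using re(2) by simp
      then have "s1 ^ 5 * Re a = Re a"
        using re(1) by linarith
      then have "s1 ^ 5 = 1"
        using re 3 by simp
      then show ?thesis
        using root1 s \<open>s2 = 1\<close> by simp
    qed
  qed
  then have "x1' = x1" "x2' = x2"
    unfolding xs by simp_all
  then show "x1 = x1' \<and> x2 = x2'"
    by simp
qed

lemma closed_S0: "closed S0"
proof -
  have eq: "S0 = {x. fst x ^ 5 + snd x ^ 5 + 1 = 0}"
    by (auto simp: S0_def)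
  show ?thesis
    unfolding eq by (intro closed_Collect_eq continuous_intros)
qed

lemma homeomorphism_F:
  assumes "0 \<le> t" "t \<le> 1"
  obtains G where "homeomorphism S0 (F t ` S0) (F t) G"
proof (rule homeomorphism_injective_closed_map[OF continuous_on_F refl inj_on_F])
  fix C assume C: "closedin (top_of_set S0) C"
  then have "C \<subseteq> S0" "closed C"
    using closedin_subset[OF C] closedin_closed_trans[OF C closed_S0] by simp_all
  have "closed (F t ` C)"
  proof (rule closed_sequential_limits[THEN iffD2], intro allI impI, elim conjE)
    fix y l assume y: "\<forall>n. y n \<in> F t ` C" and lim: "y \<longlonglongrightarrow> l"
    \<comment> \<open>The preimages of a convergent sequence are bounded, so they accumulate on the curve.\<close>
    from y obtain x where x: "\<And>n. x n \<in> C" "\<And>n. y n = F t (x n)"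
      unfolding image_iff Bex_def by metis
    obtain K where K: "\<And>n. norm (y n) \<le> K"
      using convergent_imp_bounded[OF lim] unfolding bounded_iff by blast
    have "norm (x n) \<le> 2 * K" for n
      using norm_le_norm_F[OF _ assms, of "x n"] x \<open>C \<subseteq> S0\<close> K[of n] by force
    then have "x n \<in> C \<inter> cball 0 (2 * K)" for n
      using x by simp
    moreover have "compact (C \<inter> cball 0 (2 * K))"
      using \<open>closed C\<close> by (simp add: closed_Int_compact)
    ultimately obtain k r where k: "k \<in> C \<inter> cball 0 (2 * K)" and r: "strict_mono r" "(x \<circ> r) \<longlonglongrightarrow> k"
      using seq_compactE[OF compact_imp_seq_compact] by metis
    have "(\<lambda>n. F t ((x \<circ> r) n)) \<longlonglongrightarrow> F t k"
      using k x(1) \<open>C \<subseteq> S0\<close>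
      by (intro continuous_on_tendsto_compose[OF continuous_on_F r(2)]) (auto intro!: always_eventually)
    moreover have "(\<lambda>n. F t ((x \<circ> r) n)) \<longlonglongrightarrow> l"
      using LIMSEQ_subseq_LIMSEQ[OF lim r(1)] by (simp add: o_def x(2))
    ultimately have "l = F t k"
      using LIMSEQ_unique by blast
    then show "l \<in> F t ` C"
      using k by blast
  qed
  then show "closedin (top_of_set (F t ` S0)) (F t ` C)"
    using \<open>C \<subseteq> S0\<close> by (intro closed_subset) auto
qed (rule that)

section \<open>Monomial form and positivity in the six regions\<close>

text \<open>
  An open set on which both factors are monomials in the moduli and the resulting matrix
  \<open>(1 + \<alpha>\<^sub>1, \<beta>\<^sub>1; \<alpha>\<^sub>2, 1 + \<beta>\<^sub>2)\<close> yields a positive density. Positivity is required for all positive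
  \<open>w\<^sub>1, w\<^sub>2\<close>, so that the moduli of the image point need not be expressed through those of \<open>x\<close>.
\<close>

definition nondegenerate_region :: "real \<Rightarrow> (complex \<times> complex) set \<Rightarrow> real \<Rightarrow> real \<Rightarrow> real \<Rightarrow> real \<Rightarrow> bool" where
  "nondegenerate_region t Q \<alpha>1 \<beta>1 \<alpha>2 \<beta>2 \<longleftrightarrow> open Q \<and> (\<forall>(x1, x2)\<in>Q. x1 \<noteq> 0 \<and> x2 \<noteq> 0 \<and>
     stretch t (cmod x1) (cmod x2) = cmod x1 powr \<alpha>1 * cmod x2 powr \<beta>1 \<and>
     stretch t (cmod x2) (cmod x1) = cmod x1 powr \<alpha>2 * cmod x2 powr \<beta>2 \<and>
     (\<forall>w1>0. \<forall>w2>0. pullback_density (1 + \<alpha>1) \<beta>1 \<alpha>2 (1 + \<beta>2) (cmod (x1 ^ 5)) (cmod (x2 ^ 5)) w1 w2 > 0))"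

lemma nondegenerate_region_swap:
  assumes "nondegenerate_region t Q \<alpha>1 \<beta>1 \<alpha>2 \<beta>2"
  shows "nondegenerate_region t (prod.swap -` Q) \<beta>2 \<alpha>2 \<beta>1 \<alpha>1"
proof -
  have "open (prod.swap -` Q)"
    using assms unfolding nondegenerate_region_def
    by (intro open_vimage) (auto simp: prod.swap_def intro!: continuous_intros)
  then show ?thesis
    using assms pullback_density_swap[of "1 + \<beta>2" \<alpha>2 \<beta>1 "1 + \<alpha>1"]
    by (auto simp: nondegenerate_region_def mult.commute)
qed

lemma nondegenerate_region_1_max:
  assumes "0 \<le> t" "t \<le> 1"
  shows "nondegenerate_region t {x. 0 < cmod (snd x) \<and> cmod (snd x) < cmod (fst x) \<and> cmod (fst x) < 1} (- t) 0 (- t) 0"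
  unfolding nondegenerate_region_def
proof (intro conjI ballI, goal_cases)
  case 1
  show ?case
    by (intro open_Collect_conj open_Collect_less continuous_intros)
next
  case (2 x)
  obtain x1 x2 where [simp]: "x = (x1, x2)"
    by (cases x)
  have r: "0 < cmod x2" "cmod x2 < cmod x1" "cmod x1 < 1"
    using 2 by auto
  have "stretch t (cmod x1) (cmod x2) = cmod x1 powr (- t)" "stretch t (cmod x2) (cmod x1) = cmod x1 powr (- t)"
    using r by (auto simp: stretch_def max_def powr_divide powr_minus_divide)
  moreover have "pullback_density (1 - t) 0 (- t) 1 (cmod x1 ^ 5) (cmod x2 ^ 5) w1 w2 > 0" if "w1 > 0" "w2 > 0" for w1 w2
    using assms r that by (intro pullback_density_pos_1_max power_strict_mono power_less_one_iff[THEN iffD2]) auto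
  ultimately show ?case
    using r by (auto simp: norm_power)
qed

lemma nondegenerate_region_1_mid:
  assumes "0 \<le> t" "t \<le> 1"
  shows "nondegenerate_region t {x. 0 < cmod (snd x) \<and> cmod (snd x) < 1 \<and> 1 < cmod (fst x)} (- t) 0 0 0"
  unfolding nondegenerate_region_def
proof (intro conjI ballI, goal_cases)
  case 1
  show ?case
    by (intro open_Collect_conj open_Collect_less continuous_intros)
next
  case (2 x)
  obtain x1 x2 where [simp]: "x = (x1, x2)"
    by (cases x)
  have r: "0 < cmod x2" "cmod x2 < 1" "1 < cmod x1"
    using 2 by auto
  have "stretch t (cmod x1) (cmod x2) = cmod x1 powr (- t)" "stretch t (cmod x2) (cmod x1) = 1"
    using r by (auto simp: stretch_def max_def powr_divide powr_minus_divide)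
  moreover have "pullback_density (1 - t) 0 0 1 (cmod x1 ^ 5) (cmod x2 ^ 5) w1 w2 > 0" if "w1 > 0" "w2 > 0" for w1 w2
    using assms r that by (intro pullback_density_pos_1_mid one_less_power power_less_one_iff[THEN iffD2]) auto
  ultimately show ?case
    using r by (auto simp: norm_power)
qed

lemma nondegenerate_region_1_min:
  assumes "0 \<le> t" "t \<le> 1"
  shows "nondegenerate_region t {x. 1 < cmod (snd x) \<and> cmod (snd x) < cmod (fst x)} (- t) t 0 0"
  unfolding nondegenerate_region_def
proof (intro conjI ballI, goal_cases)
  case 1
  show ?case
    by (intro open_Collect_conj open_Collect_less continuous_intros)
next
  case (2 x)
  obtain x1 x2 where [simp]: "x = (x1, x2)"
    by (cases x)
  have r: "1 < cmod x2" "cmod x2 < cmod x1"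
    using 2 by auto
  have "stretch t (cmod x1) (cmod x2) = cmod x1 powr (- t) * cmod x2 powr t" "stretch t (cmod x2) (cmod x1) = 1"
    using r by (auto simp: stretch_def max_def powr_divide powr_minus_divide)
  moreover have "pullback_density (1 - t) t 0 1 (cmod x1 ^ 5) (cmod x2 ^ 5) w1 w2 > 0" if "w1 > 0" "w2 > 0" for w1 w2
    using assms r that by (intro pullback_density_pos_1_min one_less_power power_strict_mono) auto
  ultimately show ?case
    using r by (auto simp: norm_power)
qed

text \<open>
  Both coordinates are nonzero here: a point of the curve with \<open>x\<^sub>2 = 0\<close> has \<open>r\<^sub>1 = 1\<close>, and
  likewise with the coordinates exchanged.
\<close>

lemma ex_nondegenerate_region:
  assumes "(x1, x2) \<in> S0" "(cmod x1 - 1) * (cmod x2 - 1) * (cmod x1 - cmod x2) \<noteq> 0" "0 \<le> t" "t \<le> 1"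
  obtains Q \<alpha>1 \<beta>1 \<alpha>2 \<beta>2 where "nondegenerate_region t Q \<alpha>1 \<beta>1 \<alpha>2 \<beta>2" "(x1, x2) \<in> Q"
    "\<forall>(x1, x2)\<in>Q. (cmod x1 - 1) * (cmod x2 - 1) * (cmod x1 - cmod x2) \<noteq> 0"
proof -
  define P where "P x1 x2 Q \<alpha>1 \<beta>1 \<alpha>2 \<beta>2 \<longleftrightarrow> nondegenerate_region t Q \<alpha>1 \<beta>1 \<alpha>2 \<beta>2 \<and> (x1, x2) \<in> Q \<and>
    (\<forall>(x1, x2)\<in>Q. (cmod x1 - 1) * (cmod x2 - 1) * (cmod x1 - cmod x2) \<noteq> 0)" for x1 x2 Q \<alpha>1 \<beta>1 \<alpha>2 \<beta>2
  have nz: "x2 \<noteq> 0" if "(x1, x2) \<in> S0" "cmod x1 \<noteq> 1" for x1 x2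
  proof
    assume "x2 = 0"
    then have "x1 ^ 5 = - 1"
      using that(1) by (simp add: S0_def add_eq_0_iff2)
    then have "cmod x1 ^ 5 = 1"
      by (metis norm_minus_cancel norm_one norm_power)
    then have "cmod x1 = 1"
      using power_eq_1_iff[of "cmod x1" 5] by simp
    then show False
      using that(2) by simp
  qed
  have larger: "\<exists>Q \<alpha>1 \<beta>1 \<alpha>2 \<beta>2. P x1 x2 Q \<alpha>1 \<beta>1 \<alpha>2 \<beta>2"
    if h: "x2 \<noteq> 0" "cmod x1 \<noteq> 1" "cmod x2 \<noteq> 1" "cmod x2 < cmod x1" for x1 x2
  proof -
    consider "cmod x1 < 1" | "cmod x2 < 1" "1 < cmod x1" | "1 < cmod x2"
      using h(2,3) by (metis linorder_neqE)
    then show ?thesis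
    proof cases
      case 1
      have "P x1 x2 {x. 0 < cmod (snd x) \<and> cmod (snd x) < cmod (fst x) \<and> cmod (fst x) < 1} (- t) 0 (- t) 0"
        unfolding P_def using nondegenerate_region_1_max[OF assms(3,4)] h 1 by auto
      then show ?thesis
        by (intro exI)
    next
      case 2
      have "P x1 x2 {x. 0 < cmod (snd x) \<and> cmod (snd x) < 1 \<and> 1 < cmod (fst x)} (- t) 0 0 0"
        unfolding P_def using nondegenerate_region_1_mid[OF assms(3,4)] h 2 by auto
      then show ?thesis
        by (intro exI)
    next
      case 3
      have "P x1 x2 {x. 1 < cmod (snd x) \<and> cmod (snd x) < cmod (fst x)} (- t) t 0 0"
        unfolding P_def using nondegenerate_region_1_min[OF assms(3,4)] h 3 by auto
      then show ?thesis
        by (intro exI)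
    qed
  qed
  have swap: "P x1 x2 (prod.swap -` Q) \<beta>2 \<alpha>2 \<beta>1 \<alpha>1" if "P x2 x1 Q \<alpha>1 \<beta>1 \<alpha>2 \<beta>2" for Q \<alpha>1 \<beta>1 \<alpha>2 \<beta>2
  proof -
    have "(cmod y1 - 1) * (cmod y2 - 1) * (cmod y1 - cmod y2) \<noteq> 0" if "(y2, y1) \<in> Q" for y1 y2
      using bspec[of Q _ "(y2, y1)"] \<open>P x2 x1 Q \<alpha>1 \<beta>1 \<alpha>2 \<beta>2\<close> that by (auto simp: P_def)
    then show ?thesis
      using that nondegenerate_region_swap[of t Q \<alpha>1 \<beta>1 \<alpha>2 \<beta>2] by (auto simp: P_def)
  qed
  have ne: "cmod x1 \<noteq> 1" "cmod x2 \<noteq> 1" "cmod x1 \<noteq> cmod x2"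
    using assms(2) by auto
  have "\<exists>Q \<alpha>1 \<beta>1 \<alpha>2 \<beta>2. P x1 x2 Q \<alpha>1 \<beta>1 \<alpha>2 \<beta>2"
  proof (cases "cmod x2 < cmod x1")
    case True
    then show ?thesis
      using larger[OF nz[OF assms(1) ne(1)] ne(1,2)] by blast
  next
    case False
    then have "cmod x1 < cmod x2"
      using ne(3) by simp
    then show ?thesis
      using larger[OF nz[OF S0_swap[OF assms(1)] ne(2)] ne(2,1)] swap by blast
  qed
  then show ?thesis
    using that unfolding P_def by blast
qed

section \<open>Logarithmic charts of the quintic\<close>

text \<open>
  Adding this to a logarithm of \<open>x\<close> gives a logarithm of a fifth root of \<open>w\<close> if \<open>w\<^sub>0 = x\<^sup>5\<close>; it is
  the branch that vanishes at \<open>w = w\<^sub>0\<close>.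
\<close>

definition log_quotient :: "complex \<Rightarrow> complex \<Rightarrow> complex" where
  "log_quotient w w0 = Ln (w / w0) / 5"

text \<open>
  Both \<open>z / a\<^sup>5\<close> and \<open>(- 1 - z) / b\<^sup>5\<close> stay in the right half-plane, where the principal
  logarithm is holomorphic.
\<close>

definition log_chart_domain :: "complex \<Rightarrow> complex \<Rightarrow> complex set" where
  "log_chart_domain a b = {z. 0 < Re (z / a ^ 5) \<and> 0 < Re ((- 1 - z) / b ^ 5)}"

lemma open_log_chart_domain: "open (log_chart_domain a b)"
  unfolding log_chart_domain_def divide_inverse
  by (intro open_Collect_conj open_Collect_less continuous_intros)

lemma exp_log_quotient:
  assumes "0 < Re (w / a ^ 5)"
  shows "(a * exp (log_quotient w (a ^ 5))) ^ 5 = w"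
proof -
  have "w \<noteq> 0" "a \<noteq> 0"
    using assms by auto
  have "exp (log_quotient w (a ^ 5)) ^ 5 = exp (5 * log_quotient w (a ^ 5))"
    by (simp flip: exp_of_nat_mult)
  also have "\<dots> = w / a ^ 5"
    using \<open>w \<noteq> 0\<close> \<open>a \<noteq> 0\<close> by (simp add: log_quotient_def)
  finally show ?thesis
    using \<open>a \<noteq> 0\<close> by (simp add: power_mult_distrib)
qed

text \<open>
  The condition keeps the argument of \<open>x / a\<close> below \<open>\<pi> / 5\<close>, so that the principal logarithm of its
  fifth power is five times its principal logarithm.
\<close>

lemma log_quotient_power:
  assumes "x \<noteq> 0" "a \<noteq> 0" "cmod (Ln (x / a)) < pi / 5"
  shows "a * exp (log_quotient (x ^ 5) (a ^ 5)) = x"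
proof -
  have "\<bar>Im (Ln (x / a))\<bar> < pi / 5"
    using abs_Im_le_cmod assms(3) by (rule le_less_trans)
  then have "Ln (exp (5 * Ln (x / a))) = 5 * Ln (x / a)"
    by (intro Ln_exp) auto
  moreover have "exp (5 * Ln (x / a)) = exp (Ln (x / a)) ^ 5"
    using exp_of_nat_mult[of 5 "Ln (x / a)"] by simp
  ultimately have "Ln ((x / a) ^ 5) = 5 * Ln (x / a)"
    using assms by simp
  then show ?thesis
    using assms by (simp add: log_quotient_def power_divide[symmetric])
qed

lemma has_derivative_log_quotient:
  assumes "0 < Re (z / w)"
  shows "((\<lambda>z. log_quotient z w) has_derivative (\<lambda>h. h / (5 * z))) (at z)"
proof -
  have "w \<noteq> 0" "z \<noteq> 0"
    using assms by auto
  have "z / w \<notin> \<real>\<^sub>\<le>\<^sub>0"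
    using assms complex_nonpos_Reals_iff by auto
  then have "((\<lambda>z. log_quotient z w) has_field_derivative inverse (z / w) * (1 / w) / 5) (at z)"
    unfolding log_quotient_def using \<open>w \<noteq> 0\<close> by (auto intro!: derivative_eq_intros)
  moreover have "inverse (z / w) * (1 / w) / 5 = 1 / (5 * z)"
    using \<open>w \<noteq> 0\<close> \<open>z \<noteq> 0\<close> by (simp add: field_simps)
  moreover have "(*) (1 / (5 * z)) = (\<lambda>h. h / (5 * z))"
    by (simp add: fun_eq_iff)
  ultimately show ?thesis
    unfolding has_field_derivative_def by metis
qed

text \<open>
  The curve near \<open>(a, b)\<close>, parametrized by \<open>z = X\<^sub>1\<close>, whence \<open>X\<^sub>2 = - 1 - z\<close>.
\<close>

definition quintic_chart :: "complex \<Rightarrow> complex \<Rightarrow> complex \<Rightarrow> complex \<times> complex" where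
  "quintic_chart a b z = (a * exp (log_quotient z (a ^ 5)), b * exp (log_quotient (- 1 - z) (b ^ 5)))"

lemma continuous_on_quintic_chart: "continuous_on (log_chart_domain a b) (quintic_chart a b)"
proof -
  have "continuous_on (log_chart_domain a b) (\<lambda>z. log_quotient z (a ^ 5))"
       "continuous_on (log_chart_domain a b) (\<lambda>z. log_quotient (- 1 - z) (b ^ 5))"
    unfolding log_quotient_def
    by (auto intro!: continuous_intros simp: log_chart_domain_def complex_nonpos_Reals_iff)
  then show ?thesis
    unfolding quintic_chart_def by (intro continuous_intros)
qed

text \<open>
  The inverse of the chart is \<open>x \<mapsto> x\<^sub>1\<^sup>5\<close>. A neighbourhood \<open>N\<close> of \<open>(a, b)\<close> is chosen so small that the
  branches of the fifth roots agree with the coordinates of all points of the curve in \<open>N\<close>;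
  its preimage under the chart is the parameter domain \<open>W\<close>.
\<close>

lemma local_homeomorphism_quintic_chart:
  assumes ab: "(a, b) \<in> S0" "a \<noteq> 0" "b \<noteq> 0" and Q: "open Q" "(a, b) \<in> Q"
  obtains W N where "open W" "W \<subseteq> log_chart_domain a b" "open N" "(a, b) \<in> N" "N \<subseteq> Q"
    "homeomorphism W (S0 \<inter> N) (quintic_chart a b) (\<lambda>x. fst x ^ 5)"
proof -
  let ?D = "log_chart_domain a b" and ?\<chi> = "quintic_chart a b"
  let ?P = "\<lambda>x. x \<in> Q \<and> fst x \<noteq> 0 \<and> snd x \<noteq> 0 \<and> fst x ^ 5 \<in> ?D
    \<and> cmod (Ln (fst x / a)) < pi / 5 \<and> cmod (Ln (snd x / b)) < pi / 5"
  have b5: "- 1 - a ^ 5 = b ^ 5"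
  proof -
    have "a ^ 5 + b ^ 5 + 1 = 0"
      using ab(1) by (simp add: S0_def)
    then show ?thesis
      by algebra
  qed
  have "\<forall>\<^sub>F x in nhds (a, b). ?P x"
  proof (intro eventually_conj)
    show "\<forall>\<^sub>F x in nhds (a, b). x \<in> Q"
      using Q by (rule eventually_nhds_in_open)
    show "\<forall>\<^sub>F x in nhds (a, b). fst x \<noteq> 0"
      using eventually_nhds_in_open[of "{x::complex \<times> complex. fst x \<noteq> 0}" "(a, b)"] ab(2)
      by (simp add: open_Collect_neq continuous_intros)
    show "\<forall>\<^sub>F x in nhds (a, b). snd x \<noteq> 0"
      using eventually_nhds_in_open[of "{x::complex \<times> complex. snd x \<noteq> 0}" "(a, b)"] ab(3)
      by (simp add: open_Collect_neq continuous_intros)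
    have "a ^ 5 \<in> ?D"
      using ab by (simp add: log_chart_domain_def b5)
    moreover have "open ((\<lambda>x::complex \<times> complex. fst x ^ 5) -` ?D)"
      by (intro open_vimage open_log_chart_domain continuous_intros)
    ultimately show "\<forall>\<^sub>F x in nhds (a, b). fst x ^ 5 \<in> ?D"
      using eventually_nhds_in_open[of "(\<lambda>x::complex \<times> complex. fst x ^ 5) -` ?D" "(a, b)"] by simp
    have "((\<lambda>x. cmod (Ln (fst x / a))) \<longlongrightarrow> cmod (Ln (fst (a, b) / a))) (nhds (a, b))"
      using ab(2) by (intro tendsto_intros) (auto simp: filterlim_ident)
    then show "\<forall>\<^sub>F x in nhds (a, b). cmod (Ln (fst x / a)) < pi / 5"
      by (rule order_tendstoD) (use ab(2) in simp)
    have "((\<lambda>x. cmod (Ln (snd x / b))) \<longlongrightarrow> cmod (Ln (snd (a, b) / b))) (nhds (a, b))"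
      using ab(3) by (intro tendsto_intros) (auto simp: filterlim_ident)
    then show "\<forall>\<^sub>F x in nhds (a, b). cmod (Ln (snd x / b)) < pi / 5"
      by (rule order_tendstoD) (use ab(3) in simp)
  qed
  then obtain N where N: "open N" "(a, b) \<in> N" "\<And>x. x \<in> N \<Longrightarrow> ?P x"
    unfolding eventually_nhds by metis
  define W where "W = ?D \<inter> ?\<chi> -` N"
  have "open W"
    unfolding W_def by (intro continuous_open_preimage continuous_on_quintic_chart open_log_chart_domain N(1))
  have \<chi>S0: "?\<chi> z \<in> S0" and \<chi>5: "fst (?\<chi> z) ^ 5 = z" if "z \<in> ?D" for z
    using that exp_log_quotient[of z a] exp_log_quotient[of "- 1 - z" b]
    by (simp_all add: quintic_chart_def S0_def log_chart_domain_def)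
  have \<chi>inv: "?\<chi> (fst x ^ 5) = x" if "x \<in> S0 \<inter> N" for x
  proof -
    have "- 1 - fst x ^ 5 = snd x ^ 5"
    proof -
      have "fst x ^ 5 + snd x ^ 5 + 1 = 0"
        using that by (auto simp: S0_def)
      then show ?thesis
        by algebra
    qed
    then show ?thesis
      using log_quotient_power[of "fst x" a] log_quotient_power[of "snd x" b] N(3)[of x] that ab
      by (simp add: quintic_chart_def prod_eq_iff)
  qed
  have "homeomorphism W (S0 \<inter> N) ?\<chi> (\<lambda>x. fst x ^ 5)"
  proof (rule homeomorphismI)
    show "continuous_on W ?\<chi>"
      by (rule continuous_on_subset[OF continuous_on_quintic_chart]) (simp add: W_def)
    show "continuous_on (S0 \<inter> N) (\<lambda>x. fst x ^ 5)"
      by (intro continuous_intros)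
    show "?\<chi> ` W \<subseteq> S0 \<inter> N"
    proof (rule image_subsetI)
      fix z assume "z \<in> W"
      then show "?\<chi> z \<in> S0 \<inter> N"
        using \<chi>S0[of z] by (simp add: W_def)
    qed
    show "(\<lambda>x. fst x ^ 5) ` (S0 \<inter> N) \<subseteq> W"
    proof (rule image_subsetI)
      fix x assume x: "x \<in> S0 \<inter> N"
      then show "fst x ^ 5 \<in> W"
        using N(3)[of x] by (simp add: W_def \<chi>inv[OF x])
    qed
  qed (simp_all add: \<chi>5 \<chi>inv W_def)
  then show ?thesis
    using \<open>open W\<close> N by (intro that[of W N]) (auto simp: W_def)
qed

text \<open>
  The weights \<open>\<kappa>\<^sub>1, \<kappa>\<^sub>2\<close> select the coordinate \<open>(1, 0)\<close> or \<open>(0, 1)\<close>, and the exponents \<open>\<alpha>, \<beta>\<close>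
  describe the monomial in the moduli by which it is multiplied.
\<close>

definition stretched_log_chart :: "complex \<Rightarrow> complex \<Rightarrow> complex \<Rightarrow> real \<Rightarrow> real \<Rightarrow> real \<Rightarrow> real \<Rightarrow> complex \<Rightarrow> complex" where
  "stretched_log_chart C a b \<kappa>1 \<kappa>2 \<alpha> \<beta> z = (let L1 = log_quotient z (a ^ 5); L2 = log_quotient (- 1 - z) (b ^ 5) in
     C * exp (of_real \<kappa>1 * L1 + of_real \<kappa>2 * L2 + of_real (\<alpha> * Re L1 + \<beta> * Re L2)))"

lemma has_derivative_stretched_log_chart:
  assumes "z \<in> log_chart_domain a b"
  shows "(stretched_log_chart C a b \<kappa>1 \<kappa>2 \<alpha> \<beta> has_derivative
    (\<lambda>h. stretched_log_chart C a b \<kappa>1 \<kappa>2 \<alpha> \<beta> z *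
      (of_real \<kappa>1 * (h / (5 * z)) + of_real \<kappa>2 * (h / (5 * (1 + z)))
       + of_real (\<alpha> * Re (h / (5 * z)) + \<beta> * Re (h / (5 * (1 + z))))))) (at z)"
proof -
  let ?L1 = "\<lambda>z. log_quotient z (a ^ 5)" and ?L2 = "\<lambda>z. log_quotient (- 1 - z) (b ^ 5)"
  have L1: "(?L1 has_derivative (\<lambda>h. h / (5 * z))) (at z)"
    using assms by (intro has_derivative_log_quotient) (simp add: log_chart_domain_def)
  have "((\<lambda>z. - 1 - z :: complex) has_derivative (\<lambda>h. - h)) (at z)"
    by (auto intro!: derivative_eq_intros)
  then have "(?L2 has_derivative (\<lambda>h. - h / (5 * (- 1 - z)))) (at z)"
    by (rule has_derivative_compose[OF _ has_derivative_log_quotient])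
      (use assms in \<open>simp add: log_chart_domain_def\<close>)
  moreover have "- h / (5 * (- 1 - z)) = h / (5 * (1 + z))" for h
  proof -
    have "5 * (- 1 - z) = - (5 * (1 + z))"
      by simp
    then show ?thesis
      by (simp only: minus_divide_divide)
  qed
  ultimately have L2: "(?L2 has_derivative (\<lambda>h. h / (5 * (1 + z)))) (at z)"
    by simp
  have "((\<lambda>z. of_real \<kappa>1 * ?L1 z + of_real \<kappa>2 * ?L2 z + of_real (\<alpha> * Re (?L1 z) + \<beta> * Re (?L2 z)))
      has_derivative (\<lambda>h. of_real \<kappa>1 * (h / (5 * z)) + of_real \<kappa>2 * (h / (5 * (1 + z)))
       + of_real (\<alpha> * Re (h / (5 * z)) + \<beta> * Re (h / (5 * (1 + z)))))) (at z)"
    by (intro has_derivative_add has_derivative_mult_right has_derivative_of_real has_derivative_Re L1 L2)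
  from has_derivative_mult_right[OF has_derivative_compose[OF this
        has_field_derivative_imp_has_derivative[OF DERIV_exp]], of C]
  show ?thesis
    unfolding stretched_log_chart_def Let_def by (simp add: mult.assoc)
qed

text \<open>
  The derivative of an exponential of logarithms is the same exponential times a combination of
  \<open>1 / z\<close>, \<open>1 / (1 + z)\<close> and their real parts; this makes the algebra closed under derivatives.
\<close>

definition log_chart_algebra :: "complex \<Rightarrow> complex \<Rightarrow> (complex \<Rightarrow> complex) set" where
  "log_chart_algebra a b = conj_algebra ({inverse, \<lambda>z. inverse (1 + z)} \<union>
     {stretched_log_chart C a b \<kappa>1 \<kappa>2 \<alpha> \<beta> | C \<kappa>1 \<kappa>2 \<alpha> \<beta>. True})"

lemma stretched_log_chart_in_log_chart_algebra:
  "stretched_log_chart C a b \<kappa>1 \<kappa>2 \<alpha> \<beta> \<in> log_chart_algebra a b"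
  unfolding log_chart_algebra_def by (rule conj_algebra.gen) blast

lemma deriv_closed_log_chart_algebra: "deriv_closed (log_chart_domain a b) (log_chart_algebra a b)"
  unfolding log_chart_algebra_def
proof (rule deriv_closed_conj_algebra)
  let ?D = "log_chart_domain a b"
  let ?Y = "{stretched_log_chart C a b \<kappa>1 \<kappa>2 \<alpha> \<beta> | C \<kappa>1 \<kappa>2 \<alpha> \<beta>. True}"
  let ?B = "{inverse, \<lambda>z. inverse (1 + z)} \<union> ?Y"
  have nz: "z \<noteq> 0 \<and> 1 + z \<noteq> 0" if "z \<in> ?D" for z
  proof -
    have "z \<noteq> 0" "- 1 - z \<noteq> 0"
      using that by (auto simp: log_chart_domain_def)
    moreover have "1 + z = - (- 1 - z)"
      by simp
    ultimately show ?thesis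
      by (simp only: neg_equal_0_iff_equal simp_thms)
  qed
  note intros = conj_algebra.mult conj_algebra.add conj_algebra.const conj_algebra_Re
  have inv: "inverse \<in> conj_algebra ?B" "(\<lambda>z. inverse (1 + z)) \<in> conj_algebra ?B"
    by (rule conj_algebra.gen; simp)+
  fix f assume "f \<in> ?B"
  then consider "f = inverse" | "f = (\<lambda>z. inverse (1 + z))" | "f \<in> ?Y"
    by (elim UnE insertE emptyE) simp_all
  then show "\<exists>f'. (\<forall>z\<in>?D. (f has_derivative f' z) (at z)) \<and> (\<forall>v. (\<lambda>z. f' z v) \<in> conj_algebra ?B)"
  proof cases
    case 1
    have d: "(f has_derivative (\<lambda>v. (- v) * (inverse z * inverse z))) (at z)" if "z \<in> ?D" for z
      unfolding 1 using has_derivative_inverse'[of z] nz[OF that] by (simp add: mult_ac)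
    have m: "(\<lambda>z. (- v) * (inverse z * inverse z)) \<in> conj_algebra ?B" for v
      by (intro intros inv)
    show ?thesis
      by (rule exI[of _ "\<lambda>z v. (- v) * (inverse z * inverse z)"], intro conjI ballI allI) (rule d m; assumption?)+
  next
    case 2
    have d: "(f has_derivative (\<lambda>v. (- v) * (inverse (1 + z) * inverse (1 + z)))) (at z)" if "z \<in> ?D" for z
    proof -
      have "((\<lambda>z::complex. 1 + z) has_derivative (\<lambda>v. v)) (at z)"
        by (auto intro!: derivative_eq_intros)
      from Deriv.has_derivative_inverse[OF _ this] show ?thesis
        unfolding 2 using nz[OF that] by (simp add: mult_ac)
    qed
    have m: "(\<lambda>z. (- v) * (inverse (1 + z) * inverse (1 + z))) \<in> conj_algebra ?B" for v
      by (intro intros inv)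
    show ?thesis
      by (rule exI[of _ "\<lambda>z v. (- v) * (inverse (1 + z) * inverse (1 + z))"], intro conjI ballI allI) (rule d m; assumption?)+
  next
    case 3
    obtain C \<kappa>1 \<kappa>2 \<alpha> \<beta> where f: "f = stretched_log_chart C a b \<kappa>1 \<kappa>2 \<alpha> \<beta>"
      using 3 by blast
    have f_mem: "f \<in> conj_algebra ?B"
      by (rule conj_algebra.gen, rule UnI2, rule 3)
    define f' :: "complex \<Rightarrow> complex \<Rightarrow> complex" where
      "f' z v = f z * (complex_of_real \<kappa>1 * (v / 5 * inverse z) + complex_of_real \<kappa>2 * (v / 5 * inverse (1 + z))
        + (complex_of_real \<alpha> * complex_of_real (Re (v / 5 * inverse z))
          + complex_of_real \<beta> * complex_of_real (Re (v / 5 * inverse (1 + z)))))" for z v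
    have d: "(f has_derivative f' z) (at z)" if "z \<in> ?D" for z
    proof -
      have "h / (5 * z) = h / 5 * inverse z" "h / (5 * (1 + z)) = h / 5 * inverse (1 + z)" for h
        by (simp_all only: divide_inverse inverse_mult_distrib mult.assoc)
      then show ?thesis
        unfolding f f'_def[abs_def] using has_derivative_stretched_log_chart[OF that, of C \<kappa>1 \<kappa>2 \<alpha> \<beta>]
        by (simp only: of_real_add of_real_mult)
    qed
    have m: "(\<lambda>z. f' z v) \<in> conj_algebra ?B" for v
      unfolding f'_def by (intro intros inv f_mem)
    show ?thesis
      by (rule exI[of _ f'], intro conjI ballI allI) (rule d m; assumption?)+
  qed
qed

section \<open>Charts of the deformed surface\<close>

definition stretched_quintic_chart :: "complex \<Rightarrow> complex \<Rightarrow> real \<Rightarrow> real \<Rightarrow> real \<Rightarrow> real \<Rightarrow> complex \<Rightarrow> complex \<times> complex" where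
  "stretched_quintic_chart a b \<alpha>1 \<beta>1 \<alpha>2 \<beta>2 z =
    (stretched_log_chart (of_real (cmod a powr \<alpha>1 * cmod b powr \<beta>1) * a) a b 1 0 \<alpha>1 \<beta>1 z,
     stretched_log_chart (of_real (cmod a powr \<alpha>2 * cmod b powr \<beta>2) * b) a b 0 1 \<alpha>2 \<beta>2 z)"

lemma F_quintic_chart:
  assumes reg: "nondegenerate_region t Q \<alpha>1 \<beta>1 \<alpha>2 \<beta>2" and "quintic_chart a b z \<in> Q"
  shows "F t (quintic_chart a b z) = stretched_quintic_chart a b \<alpha>1 \<beta>1 \<alpha>2 \<beta>2 z"
proof -
  define L1 L2 where "L1 = log_quotient z (a ^ 5)" and "L2 = log_quotient (- 1 - z) (b ^ 5)"
  have \<chi>: "quintic_chart a b z = (a * exp L1, b * exp L2)"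
    by (simp add: quintic_chart_def L1_def L2_def)
  have "a \<noteq> 0" "b \<noteq> 0"
    and s: "stretch t (cmod (a * exp L1)) (cmod (b * exp L2)) = cmod (a * exp L1) powr \<alpha>1 * cmod (b * exp L2) powr \<beta>1"
      "stretch t (cmod (b * exp L2)) (cmod (a * exp L1)) = cmod (a * exp L1) powr \<alpha>2 * cmod (b * exp L2) powr \<beta>2"
    using assms by (auto simp: nondegenerate_region_def \<chi>)
  have "cmod (a * exp L1) powr \<alpha> * cmod (b * exp L2) powr \<beta> =
      cmod a powr \<alpha> * cmod b powr \<beta> * exp (\<alpha> * Re L1 + \<beta> * Re L2)" for \<alpha> \<beta>
    by (simp add: norm_mult norm_exp powr_mult exp_powr_real exp_add mult.commute mult.left_commute)
  moreover have "exp (of_real 1 * L1 + of_real 0 * L2 + of_real r) = of_real (exp r) * exp L1"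
    "exp (of_real 0 * L1 + of_real 1 * L2 + of_real r) = of_real (exp r) * exp L2" for r
    by (simp_all add: exp_add exp_of_real)
  ultimately show ?thesis
    unfolding \<chi> F_eq_stretch s stretched_quintic_chart_def stretched_log_chart_def Let_def
      L1_def[symmetric] L2_def[symmetric]
    by (simp only: of_real_mult mult_ac)
qed

definition stretched_quintic_derivative :: "complex \<Rightarrow> complex \<Rightarrow> real \<Rightarrow> real \<Rightarrow> real \<Rightarrow> real \<Rightarrow> complex \<Rightarrow> complex \<Rightarrow> complex \<times> complex" where
  "stretched_quintic_derivative a b \<alpha>1 \<beta>1 \<alpha>2 \<beta>2 z h =
    (let y = stretched_quintic_chart a b \<alpha>1 \<beta>1 \<alpha>2 \<beta>2 z; u1 = h / (5 * z); u2 = h / (5 * (1 + z)) in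
     (fst y * Complex ((1 + \<alpha>1) * Re u1 + \<beta>1 * Re u2) (Im u1),
      snd y * Complex (\<alpha>2 * Re u1 + (1 + \<beta>2) * Re u2) (Im u2)))"

lemma has_derivative_stretched_quintic_chart:
  assumes "z \<in> log_chart_domain a b"
  shows "(stretched_quintic_chart a b \<alpha>1 \<beta>1 \<alpha>2 \<beta>2 has_derivative
    stretched_quintic_derivative a b \<alpha>1 \<beta>1 \<alpha>2 \<beta>2 z) (at z)"
proof -
  have 1: "of_real 1 * u1 + of_real 0 * u2 + of_real (\<alpha>1 * Re u1 + \<beta>1 * Re u2) =
      Complex ((1 + \<alpha>1) * Re u1 + \<beta>1 * Re u2) (Im u1)"
    and 2: "of_real 0 * u1 + of_real 1 * u2 + of_real (\<alpha>2 * Re u1 + \<beta>2 * Re u2) =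
      Complex (\<alpha>2 * Re u1 + (1 + \<beta>2) * Re u2) (Im u2)" for u1 u2
    by (simp_all add: complex_eq_iff algebra_simps)
  have eq: "stretched_quintic_chart a b \<alpha>1 \<beta>1 \<alpha>2 \<beta>2 = (\<lambda>z.
    (stretched_log_chart (of_real (cmod a powr \<alpha>1 * cmod b powr \<beta>1) * a) a b 1 0 \<alpha>1 \<beta>1 z,
     stretched_log_chart (of_real (cmod a powr \<alpha>2 * cmod b powr \<beta>2) * b) a b 0 1 \<alpha>2 \<beta>2 z))"
    by (simp add: stretched_quintic_chart_def fun_eq_iff)
  have eq': "stretched_quintic_derivative a b \<alpha>1 \<beta>1 \<alpha>2 \<beta>2 z = (\<lambda>h.
    (fst (stretched_quintic_chart a b \<alpha>1 \<beta>1 \<alpha>2 \<beta>2 z) *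
      Complex ((1 + \<alpha>1) * Re (h / (5 * z)) + \<beta>1 * Re (h / (5 * (1 + z)))) (Im (h / (5 * z))),
     snd (stretched_quintic_chart a b \<alpha>1 \<beta>1 \<alpha>2 \<beta>2 z) *
      Complex (\<alpha>2 * Re (h / (5 * z)) + (1 + \<beta>2) * Re (h / (5 * (1 + z)))) (Im (h / (5 * (1 + z))))))"
    by (rule ext) (simp only: stretched_quintic_derivative_def Let_def)
  show ?thesis
    unfolding eq' stretched_quintic_chart_def fst_conv snd_conv 1[symmetric] 2[symmetric] unfolding eq
    by (intro has_derivative_Pair has_derivative_stretched_log_chart assms)
qed

text \<open>
  A tangent vector \<open>h\<close> of the \<open>z\<close>-plane has \<open>d\<zeta>\<^sub>1 = h / (5 * X\<^sub>1)\<close> and \<open>d\<zeta>\<^sub>2 = - h / (5 * X\<^sub>2)\<close>, that is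
  \<open>- X\<^sub>2 * \<tau>\<close> and \<open>X\<^sub>1 * \<tau>\<close> with \<open>\<tau> = - h / (5 * X\<^sub>1 * X\<^sub>2)\<close>.
\<close>

lemma fubini_study_stretched_quintic_chart:
  assumes z: "z \<in> log_chart_domain a b" and reg: "nondegenerate_region t Q \<alpha>1 \<beta>1 \<alpha>2 \<beta>2"
    and Q: "quintic_chart a b z \<in> Q" and "h \<noteq> 0"
  defines "y \<equiv> stretched_quintic_chart a b \<alpha>1 \<beta>1 \<alpha>2 \<beta>2 z"
    and "D \<equiv> stretched_quintic_derivative a b \<alpha>1 \<beta>1 \<alpha>2 \<beta>2 z"
  shows "fubini_study y (D h) (D (\<i> * h)) > 0"
proof -
  define X2 where "X2 = - 1 - z"
  define \<tau> where "\<tau> = - h / (5 * (z * X2))"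
  have nz: "z \<noteq> 0" "X2 \<noteq> 0"
    using z by (auto simp: log_chart_domain_def X2_def)
  have u: "- X2 * \<tau> = h / (5 * z)" "z * \<tau> = h / (5 * (1 + z))"
    "- X2 * (\<i> * \<tau>) = \<i> * h / (5 * z)" "z * (\<i> * \<tau>) = \<i> * h / (5 * (1 + z))"
  proof -
    have "1 + z = - X2"
      by (simp add: X2_def)
    then show "- X2 * \<tau> = h / (5 * z)" "z * \<tau> = h / (5 * (1 + z))"
      "- X2 * (\<i> * \<tau>) = \<i> * h / (5 * z)" "z * (\<i> * \<tau>) = \<i> * h / (5 * (1 + z))"
      using nz by (simp_all add: \<tau>_def field_simps)
  qed
  have "\<tau> \<noteq> 0"
    using nz \<open>h \<noteq> 0\<close> by (simp add: \<tau>_def)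
  have x5: "(a * exp (log_quotient z (a ^ 5))) ^ 5 = z" "(b * exp (log_quotient (- 1 - z) (b ^ 5))) ^ 5 = X2"
    using z by (auto simp: X2_def log_chart_domain_def intro!: exp_log_quotient)
  have "a \<noteq> 0" "b \<noteq> 0"
    using z by (auto simp: log_chart_domain_def)
  then have y: "fst y \<noteq> 0" "snd y \<noteq> 0"
    by (simp_all add: y_def stretched_quintic_chart_def stretched_log_chart_def Let_def)
  have "pullback_density (1 + \<alpha>1) \<beta>1 \<alpha>2 (1 + \<beta>2) (cmod z) (cmod X2) ((cmod (fst y))\<^sup>2) ((cmod (snd y))\<^sup>2) > 0"
    using reg Q y unfolding nondegenerate_region_def quintic_chart_def by (auto simp: x5 simp del: power_mult_distrib)
  moreover have "fubini_study (fst y, snd y) (D h) (D (\<i> * h)) =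
     2 * (cmod \<tau>)\<^sup>2 / (1 + (cmod (fst y))\<^sup>2 + (cmod (snd y))\<^sup>2)\<^sup>2
     * pullback_density (1 + \<alpha>1) \<beta>1 \<alpha>2 (1 + \<beta>2) (cmod z) (cmod X2) ((cmod (fst y))\<^sup>2) ((cmod (snd y))\<^sup>2)"
    using fubini_study_pullback_line[of z X2 "fst y" "snd y" "1 + \<alpha>1" \<tau> \<beta>1 \<alpha>2 "1 + \<beta>2"]
    unfolding u fst_conv snd_conv D_def stretched_quintic_derivative_def Let_def y_def[symmetric]
    by (simp add: X2_def)
  moreover have "2 * (cmod \<tau>)\<^sup>2 / (1 + (cmod (fst y))\<^sup>2 + (cmod (snd y))\<^sup>2)\<^sup>2 > 0"
    using \<open>\<tau> \<noteq> 0\<close> by (intro divide_pos_pos zero_less_power add_pos_nonneg) auto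
  ultimately show ?thesis
    by (simp only: prod.collapse mult_pos_pos)
qed

theorem lemma9p1:
  fixes t :: real
  assumes "t \<in> {0..1}"
  shows "symplectic_surface
           (F t ` {(x1, x2) \<in> S0. (cmod x1 - 1) * (cmod x2 - 1) * (cmod x1 - cmod x2) \<noteq> 0})"
    (is "symplectic_surface (F t ` ?S)")
proof (rule symplectic_surface_if_charts)
  have t: "0 \<le> t" "t \<le> 1"
    using assms by auto
  obtain G where G: "homeomorphism S0 (F t ` S0) (F t) G"
    using homeomorphism_F[OF t] .
  fix p assume "p \<in> F t ` ?S"
  then obtain a b where p: "p = F t (a, b)" and ab: "(a, b) \<in> S0"
    "(cmod a - 1) * (cmod b - 1) * (cmod a - cmod b) \<noteq> 0"
    by auto
  obtain Q \<alpha>1 \<beta>1 \<alpha>2 \<beta>2 where reg: "nondegenerate_region t Q \<alpha>1 \<beta>1 \<alpha>2 \<beta>2" "(a, b) \<in> Q"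
    and QS: "\<forall>(x1, x2)\<in>Q. (cmod x1 - 1) * (cmod x2 - 1) * (cmod x1 - cmod x2) \<noteq> 0"
    using ex_nondegenerate_region[OF ab t] .
  have "open Q" "a \<noteq> 0" "b \<noteq> 0"
    using reg by (auto simp: nondegenerate_region_def)
  then obtain W N where W: "open W" "W \<subseteq> log_chart_domain a b"
    and N: "open N" "(a, b) \<in> N" "N \<subseteq> Q"
    and \<chi>: "homeomorphism W (S0 \<inter> N) (quintic_chart a b) (\<lambda>x. fst x ^ 5)"
    using local_homeomorphism_quintic_chart[OF ab(1) _ _ _ reg(2)] by metis
  have NS: "S0 \<inter> N \<subseteq> ?S"
    using N(3) QS by blast
  \<comment> \<open>This is where the homeomorphism on the whole curve enters: no other part of the curve may be
    mapped close to \<open>p\<close>.\<close>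
  have "openin (top_of_set (F t ` S0)) (F t ` (S0 \<inter> N))"
    using homeomorphism_imp_open_map[OF G] N(1) by (simp add: openin_open_Int)
  then obtain V where V: "open V" "F t ` (S0 \<inter> N) = F t ` S0 \<inter> V"
    by (auto simp: openin_open)
  have MV: "F t ` ?S \<inter> V = F t ` (S0 \<inter> N)"
    using V(2) NS by blast
  define \<Phi> where "\<Phi> = stretched_quintic_chart a b \<alpha>1 \<beta>1 \<alpha>2 \<beta>2"
  let ?\<F> = "log_chart_algebra a b"
  have \<F>: "deriv_closed (log_chart_domain a b) {(\<lambda>z. (f z, g z)) | f g. f \<in> ?\<F> \<and> g \<in> ?\<F>}"
    by (intro deriv_closed_Pair deriv_closed_log_chart_algebra)
  have \<chi>Q: "quintic_chart a b z \<in> Q" if "z \<in> W" for z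
    using homeomorphism_image1[OF \<chi>] N(3) that by blast
  have \<Phi>: "\<Phi> z = F t (quintic_chart a b z)" if "z \<in> W" for z
    using F_quintic_chart[OF reg(1) \<chi>Q[OF that]] by (simp add: \<Phi>_def)
  show "\<exists>V W (\<Phi> :: complex \<Rightarrow> complex \<times> complex) \<psi> D \<F>.
      open V \<and> p \<in> V \<and> open W \<and> homeomorphism W (F t ` ?S \<inter> V) \<Phi> \<psi> \<and> deriv_closed W \<F> \<and> \<Phi> \<in> \<F>
      \<and> (\<forall>z\<in>W. (\<Phi> has_derivative D z) (at z))
      \<and> (\<forall>z\<in>W. \<forall>h. h \<noteq> 0 \<longrightarrow> fubini_study (\<Phi> z) (D z h) (D z (\<i> * h)) \<noteq> 0)"
  proof (intro exI conjI ballI allI impI)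
    show "p \<in> V"
      using V(2) ab(1) N(2) by (auto simp: p)
    have "homeomorphism (S0 \<inter> N) (F t ` (S0 \<inter> N)) (F t) G"
      by (rule homeomorphism_of_subsets[OF G _ subset_refl refl]) simp
    with \<chi> have "homeomorphism W (F t ` (S0 \<inter> N)) (F t \<circ> quintic_chart a b) ((\<lambda>x. fst x ^ 5) \<circ> G)"
      by (rule homeomorphism_compose)
    then show "homeomorphism W (F t ` ?S \<inter> V) \<Phi> ((\<lambda>x. fst x ^ 5) \<circ> G)"
      unfolding MV by (rule homeomorphism_cong) (simp_all add: \<Phi>)
    show "deriv_closed W {(\<lambda>z. (f z, g z)) | f g. f \<in> ?\<F> \<and> g \<in> ?\<F>}"
      using \<F> W(2) unfolding deriv_closed_def by (meson subsetD)
    show "\<Phi> \<in> {(\<lambda>z. (f z, g z)) | f g. f \<in> ?\<F> \<and> g \<in> ?\<F>}"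
      unfolding \<Phi>_def stretched_quintic_chart_def[abs_def]
      by (intro CollectI exI conjI, rule refl) (rule stretched_log_chart_in_log_chart_algebra)+
    fix z assume z: "z \<in> W"
    show "(\<Phi> has_derivative stretched_quintic_derivative a b \<alpha>1 \<beta>1 \<alpha>2 \<beta>2 z) (at z)"
      unfolding \<Phi>_def using z W(2) by (intro has_derivative_stretched_quintic_chart) blast
    show "fubini_study (\<Phi> z) (stretched_quintic_derivative a b \<alpha>1 \<beta>1 \<alpha>2 \<beta>2 z h)
        (stretched_quintic_derivative a b \<alpha>1 \<beta>1 \<alpha>2 \<beta>2 z (\<i> * h)) \<noteq> 0" if "h \<noteq> 0" for h
      using fubini_study_stretched_quintic_chart[OF _ reg(1) \<chi>Q[OF z] that] z W(2)
      unfolding \<Phi>_def by (metis less_irrefl subsetD)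
  qed (fact V(1) W(1))+
qed

end
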